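(* There exist absolute constants $c,C>0$ such that the following holds. Identify edges of the complete bipartite graph $K_{n,n}$ with $[n]\times[n]$, call $(i,j)\sim(i',j')$ adjacent if they are distinct and $i=i'$ or $j=j'$, and for $x=(x_{ij})\in\mathbb C^{[n]\times[n]}$ let \[ Z_{G_n}(x):=\sum_{M\text{ matching in }K_{n,n}}\prod_{e\in M}x_e,\qquad F^{(2)}_n(x):=Z_{G_n}(x)\exp(-L_1(x)-L_2(x)), \] where $L_1(x)=\sum_{(i,j)}x_{ij}$ and $L_2(x)=-\frac12\sum_{(i,j)}x_{ij}^2-\sum_{(i,j)\sim(i',j')}x_{ij}x_{i'j'}$, the last sum being over unordered adjacent pairs. Let $W=(W_{ij})$ have i.i.d. entries $\mathcal N_{\mathbb C}(0,1)$ and $X^{(2)}_n(z):=F^{(2)}_n(zW)$. If $n|z|^2\le c$, then \[ \log\mathbb E\bigl[|X^{(2)}_n(z)|^2\bigr]\le C\,n^4|z|^6. \]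
   Context: $G_n=L(K_{n,n})$ is the line graph of $K_{n,n}$; $Z_{G_n}$ is its hardcore (independence) polynomial, equal to the matching polynomial of $K_{n,n}$ (the empty matching contributes $1$). $\mathcal N_{\mathbb C}(0,1)$ is the standard circularly symmetric complex Gaussian. *)

theory Defs
  imports "HOL-Probability.Probability"
begin

definition edges :: "nat \<Rightarrow> (nat \<times> nat) set" where
  "edges n = {1..n} \<times> {1..n}"

definition adjacent :: "nat \<times> nat \<Rightarrow> nat \<times> nat \<Rightarrow> bool" where
  "adjacent e f \<longleftrightarrow> e \<noteq> f \<and> (fst e = fst f \<or> snd e = snd f)"

definition matchings :: "nat \<Rightarrow> (nat \<times> nat) set set" where
  "matchings n = {M. M \<subseteq> edges n \<and> (\<forall>e\<in>M. \<forall>f\<in>M. \<not> adjacent e f)}"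

definition adjacent_pairs :: "nat \<Rightarrow> (nat \<times> nat) set set" where
  "adjacent_pairs n = {{e, f} | e f. e \<in> edges n \<and> f \<in> edges n \<and> adjacent e f}"

definition Z :: "nat \<Rightarrow> (nat \<times> nat \<Rightarrow> complex) \<Rightarrow> complex" where
  "Z n x = (\<Sum>M\<in>matchings n. \<Prod>e\<in>M. x e)"

definition L1 :: "nat \<Rightarrow> (nat \<times> nat \<Rightarrow> complex) \<Rightarrow> complex" where
  "L1 n x = (\<Sum>e\<in>edges n. x e)"

(* Each P in adjacent_pairs n is a two-element set {e, f}, so the inner product is x e * x f. *)
definition L2 :: "nat \<Rightarrow> (nat \<times> nat \<Rightarrow> complex) \<Rightarrow> complex" where
  "L2 n x = - (1 / 2) * (\<Sum>e\<in>edges n. (x e)\<^sup>2) - (\<Sum>P\<in>adjacent_pairs n. \<Prod>e\<in>P. x e)"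

definition F2 :: "nat \<Rightarrow> (nat \<times> nat \<Rightarrow> complex) \<Rightarrow> complex" where
  "F2 n x = Z n x * exp (- L1 n x - L2 n x)"

definition X2 :: "nat \<Rightarrow> complex \<Rightarrow> (nat \<times> nat \<Rightarrow> complex) \<Rightarrow> complex" where
  "X2 n z W = F2 n (\<lambda>e. z * W e)"

(* Real and imaginary parts are independent centred normals of variance 1/2, so that E |w|^2 = 1. *)
definition std_complex_gaussian :: "complex measure" where
  "std_complex_gaussian =
     distr (density lborel (normal_density 0 (1 / sqrt 2)) \<Otimes>\<^sub>M
            density lborel (normal_density 0 (1 / sqrt 2)))
       borel (\<lambda>(a, b). Complex a b)"

(* The joint law of an n x n matrix W with i.i.d. standard complex Gaussian entries. *)
definition gaussian_matrix :: "nat \<Rightarrow> (nat \<times> nat \<Rightarrow> complex) measure" where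
  "gaussian_matrix n = Pi\<^sub>M (edges n) (\<lambda>_. std_complex_gaussian)"

lemma sets_std_complex_gaussian [measurable_cong]: "sets std_complex_gaussian = sets borel"
  by (simp add: std_complex_gaussian_def)

lemma Complex_measurable: "(\<lambda>(a, b). Complex a b) \<in> borel_measurable (borel \<Otimes>\<^sub>M borel)"
  unfolding Complex_eq case_prod_beta by measurable

lemma prob_space_std_complex_gaussian: "prob_space std_complex_gaussian"
proof -
  let ?N = "density lborel (normal_density 0 (1 / sqrt 2))"
  interpret N: prob_space ?N by (rule prob_space_normal_density) simp
  interpret P: pair_prob_space ?N ?N ..
  have "sets (?N \<Otimes>\<^sub>M ?N) = sets (borel \<Otimes>\<^sub>M borel)"
    by (intro sets_pair_measure_cong) simp_all
  then have "(\<lambda>(a, b). Complex a b) \<in> borel_measurable (?N \<Otimes>\<^sub>M ?N)"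
    using Complex_measurable measurable_cong_sets by blast
  then show ?thesis
    unfolding std_complex_gaussian_def by (rule P.prob_space_distr)
qed

lemma prob_space_gaussian_matrix: "prob_space (gaussian_matrix n)"
  unfolding gaussian_matrix_def by (intro prob_space_PiM prob_space_std_complex_gaussian)

lemma X2_measurable: "X2 n z \<in> borel_measurable (gaussian_matrix n)"
proof -
  have fin: "M \<subseteq> edges n" if "M \<in> matchings n \<union> adjacent_pairs n" for M
    using that by (auto simp: matchings_def adjacent_pairs_def)
  have W: "(\<lambda>W. W e) \<in> borel_measurable (gaussian_matrix n)" if "e \<in> edges n" for e
  proof -
    have "(\<lambda>W. W e) \<in> measurable (gaussian_matrix n) std_complex_gaussian"
      unfolding gaussian_matrix_def using that by (rule measurable_component_singleton)
    then show ?thesis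
      using measurable_cong_sets[OF refl sets_std_complex_gaussian] by blast
  qed
  have zW: "(\<lambda>W. z * W e) \<in> borel_measurable (gaussian_matrix n)" if "e \<in> edges n" for e
    by (intro borel_measurable_times borel_measurable_const W that)
  have "(\<lambda>W. \<Prod>e\<in>M. z * W e) \<in> borel_measurable (gaussian_matrix n)"
    if "M \<in> matchings n \<union> adjacent_pairs n" for M
    using fin[OF that] by (intro borel_measurable_prod zW) auto
  then show ?thesis
    unfolding X2_def F2_def Z_def L1_def L2_def
    by (intro borel_measurable_times measurable_compose[OF _ borel_measurable_exp]
        borel_measurable_diff borel_measurable_uminus borel_measurable_sum borel_measurable_power
        borel_measurable_const zW) auto
qed

(* Stating the result for the law gaussian_matrix n loses no generality: on any probability space,
   entries W e that are i.i.d. standard complex Gaussian give the same integrability and mean. *)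
lemma iid_entries_same_expectation:
  fixes \<Omega> :: "'a measure" and W :: "nat \<times> nat \<Rightarrow> 'a \<Rightarrow> complex"
  assumes "prob_space \<Omega>"
    and indep: "prob_space.indep_vars \<Omega> (\<lambda>_. borel) W (edges n)"
    and law: "\<And>e. e \<in> edges n \<Longrightarrow> distr \<Omega> borel (W e) = std_complex_gaussian"
  shows "integrable \<Omega> (\<lambda>\<omega>. (cmod (X2 n z (\<lambda>e. W e \<omega>)))\<^sup>2) \<longleftrightarrow>
         integrable (gaussian_matrix n) (\<lambda>w. (cmod (X2 n z w))\<^sup>2)"
    and "prob_space.expectation \<Omega> (\<lambda>\<omega>. (cmod (X2 n z (\<lambda>e. W e \<omega>)))\<^sup>2) =
         prob_space.expectation (gaussian_matrix n) (\<lambda>w. (cmod (X2 n z w))\<^sup>2)"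
proof -
  interpret prob_space \<Omega> by fact
  let ?W = "\<lambda>\<omega>. \<lambda>e\<in>edges n. W e \<omega>"
  have rv: "random_variable borel (W e)" if "e \<in> edges n" for e
    using indep that by (simp add: indep_vars_def)
  have "distr \<Omega> (Pi\<^sub>M (edges n) (\<lambda>_. borel)) ?W = Pi\<^sub>M (edges n) (\<lambda>e. distr \<Omega> borel (W e))"
  proof (cases "edges n = {}")
    case True
    have e: "restrict (\<lambda>e. W e \<omega>) {} = (\<lambda>_. undefined)" for \<omega> by auto
    show ?thesis unfolding True e PiM_empty
    proof (rule measure_eqI)
      fix A assume "A \<in> sets (distr \<Omega> (count_space {\<lambda>_. undefined}) (\<lambda>\<omega>. (\<lambda>_::nat \<times> nat. undefined :: complex)))"
      then have "A = {} \<or> A = {\<lambda>_. undefined}" by auto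
      then show "emeasure (distr \<Omega> (count_space {\<lambda>_. undefined}) (\<lambda>\<omega>. (\<lambda>_::nat \<times> nat. undefined :: complex))) A
        = emeasure (count_space {\<lambda>_. undefined}) A"
        by (auto simp: emeasure_distr emeasure_space_1)
    qed simp
  next
    case False
    then show ?thesis using indep rv by (subst (asm) indep_vars_iff_distr_eq_PiM') auto
  qed
  also have "\<dots> = gaussian_matrix n"
    unfolding gaussian_matrix_def by (intro PiM_cong refl law)
  finally have D: "distr \<Omega> (Pi\<^sub>M (edges n) (\<lambda>_. borel)) ?W = gaussian_matrix n" .
  have m: "?W \<in> measurable \<Omega> (Pi\<^sub>M (edges n) (\<lambda>_. borel))"
    by (intro measurable_restrict rv)
  have f: "(\<lambda>w. (cmod (X2 n z w))\<^sup>2) \<in> borel_measurable (Pi\<^sub>M (edges n) (\<lambda>_. borel))"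
    using X2_measurable[of n z] D[symmetric] by simp
  have sub: "M \<subseteq> edges n" if "M \<in> matchings n \<or> M \<in> adjacent_pairs n" for M
    using that by (auto simp: matchings_def adjacent_pairs_def)
  have eq: "X2 n z (?W \<omega>) = X2 n z (\<lambda>e. W e \<omega>)" for \<omega>
    unfolding X2_def F2_def Z_def L1_def L2_def
    by (intro arg_cong2[where f="(*)"] arg_cong2[where f="(-)"] arg_cong[where f=exp]
        arg_cong[where f=uminus] sum.cong prod.cong refl) (use sub in auto)
  show "integrable \<Omega> (\<lambda>\<omega>. (cmod (X2 n z (\<lambda>e. W e \<omega>)))\<^sup>2) \<longleftrightarrow>
        integrable (gaussian_matrix n) (\<lambda>w. (cmod (X2 n z w))\<^sup>2)"
    using integrable_distr_eq[OF m f] unfolding D eq by simp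
  show "expectation (\<lambda>\<omega>. (cmod (X2 n z (\<lambda>e. W e \<omega>)))\<^sup>2) =
        prob_space.expectation (gaussian_matrix n) (\<lambda>w. (cmod (X2 n z w))\<^sup>2)"
    using integral_distr[OF m f] unfolding D eq by simp
qed

end

theory Submission
  imports Defs "HOL-Real_Asymp.Real_Asymp"
begin

text \<open>Write \<open>x = z W\<close>, \<open>q = n |z|\<^sup>2\<close>, \<open>\<parallel>g\<parallel>\<^sup>2 = E |g (z W)|\<^sup>2\<close>, and let \<open>u\<^sub>S\<close> be the partition
  function of the matchings avoiding the vertex set \<open>S\<close>, multiplied by \<open>exp (- L\<^sub>1 - L\<^sub>2)\<close> (\<open>weighted_Z n S\<close>); so
  \<open>F = u\<^sub>\<emptyset>\<close>. On holomorphic functions multiplication by \<open>x\<^sub>e\<close> is the adjoint of \<open>|z|\<^sup>2 \<partial>\<^sub>e\<close>, which gives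
  \<open>\<parallel>\<Sum>\<^sub>f x\<^sub>f v\<^sub>f\<parallel>\<^sup>2 \<le> |z|\<^sup>2 \<Sum>\<^sub>f \<parallel>v\<^sub>f\<parallel>\<^sup>2 + |z|\<^sup>4 \<Sum>\<^sub>f\<^sub>,\<^sub>f\<^sub>' \<parallel>\<partial>\<^sub>f\<^sub>' v\<^sub>f\<parallel>\<^sup>2\<close>.
  Expanding along a vertex \<open>v\<close>, \<open>u\<^sub>S - u\<^bsub>S \<union> v\<^esub> = \<Sum> x\<^sub>f u\<^bsub>S \<union> f\<^esub>\<close> over the edges \<open>f\<close> at \<open>v\<close> that avoid \<open>S\<close>, so by downward
  induction on \<open>S\<close> deleting a vertex changes \<open>u\<^sub>S\<close> by a relative \<open>O(\<surd>q)\<close> only. Since \<open>L\<^sub>1 + L\<^sub>2\<close> is the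
  expansion of \<open>log Z\<close> to second order, \<open>\<partial>\<^sub>e F = \<Sum> x\<^sub>f (u\<^sub>\<emptyset> - u\<^sub>T)\<close> over the edges \<open>f\<close> meeting \<open>e\<close>, with
  three deleted vertices \<open>T = T(f)\<close>; hence \<open>\<parallel>\<partial>\<^sub>e F\<parallel>\<^sup>2 = O(q\<^sup>2) \<parallel>F\<parallel>\<^sup>2\<close>.
  Finally \<open>\<phi>(s) = E |F (s z W)|\<^sup>2\<close> satisfies \<open>s \<phi>'(s) = 2 |s z|\<^sup>2 \<Sum>\<^sub>e \<parallel>\<partial>\<^sub>e F\<parallel>\<^sup>2\<close> (norms at scale \<open>s z\<close>), so
  \<open>(log \<phi>)' = O(n\<^sup>4 |z|\<^sup>6 s\<^sup>5)\<close>.\<close>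

section \<open>Gaussian integration by parts\<close>

abbreviation half_normal :: "real measure" where
  "half_normal \<equiv> density lborel (normal_density 0 (1 / sqrt 2))"

lemma normal_density_half: "normal_density 0 (1 / sqrt 2) a = exp (- a\<^sup>2) / sqrt pi"
  by (simp add: normal_density_def power_divide)

text \<open>Multiplying the density \<open>exp (- a\<^sup>2) / sqrt pi\<close> by
  \<open>exp (c * a\<^sup>2)\<close> gives a multiple of another centred normal density, of variance
  \<open>1 / (2 * (1 - c))\<close>.\<close>

lemma integrable_half_normal_exp:
  assumes "c < 1"
  shows "integrable half_normal (\<lambda>a. exp (c * a\<^sup>2))"
proof -
  define s where "s = 1 / sqrt (2 * (1 - c))"
  have s: "s > 0" "2 * s\<^sup>2 = 1 / (1 - c)" using assms by (auto simp: s_def power_divide divide_simps)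
  have "integrable lborel (\<lambda>a. sqrt (2 * pi * s\<^sup>2) / sqrt pi * normal_density 0 s a)"
    using s by (intro integrable_mult_right) simp
  also have "(\<lambda>a. sqrt (2 * pi * s\<^sup>2) / sqrt pi * normal_density 0 s a) =
      (\<lambda>a. normal_density 0 (1 / sqrt 2) a *\<^sub>R exp (c * a\<^sup>2))"
    using s by (auto simp: normal_density_half normal_density_def fun_eq_iff exp_add[symmetric] field_simps)
  finally show ?thesis
    by (subst integrable_density) auto
qed

text \<open>The density \<open>r\<close> satisfies \<open>r' = - 2 a r\<close>, so
  \<open>r f' - 2 a r f\<close> is the derivative of \<open>r f\<close>. Its integral over the line
  vanishes by the fundamental theorem, because \<open>r f\<close> decays like
  \<open>exp (- a\<^sup>2 / 2)\<close>.\<close>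

lemma half_normal_integration_by_parts:
  fixes f f' :: "real \<Rightarrow> complex"
  assumes d: "\<And>a. (f has_vector_derivative f' a) (at a)" and c: "continuous_on UNIV f'"
    and bf: "\<And>a. norm (f a) \<le> B * exp (a\<^sup>2 / 2)" and bf': "\<And>a. norm (f' a) \<le> B * exp (a\<^sup>2 / 2)"
  shows "(\<integral>a. of_real a * f a \<partial>half_normal) = (\<integral>a. f' a \<partial>half_normal) / 2"
    and "integrable half_normal (\<lambda>a. of_real a * f a)" and "integrable half_normal f'"
proof -
  have cf: "continuous_on UNIV f"
    using d by (meson continuous_at_imp_continuous_on has_vector_derivative_continuous)
  have meas [measurable]: "f \<in> borel_measurable borel" "f' \<in> borel_measurable borel"
    using c cf by (auto intro: borel_measurable_continuous_onI)
  have B: "B \<ge> 0" using order_trans[OF norm_ge_zero bf[of 0]] by simp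
  show i2: "integrable half_normal f'"
    by (rule Bochner_Integration.integrable_bound[OF integrable_mult_right[OF integrable_half_normal_exp[of "1/2"], of B]])
       (use bf' B in auto)
  \<comment> \<open>The factor \<open>a\<close> costs at most
    \<open>4 * exp (a\<^sup>2 / 4)\<close>, which raises the exponent from 1/2 to 3/4, still below
    1.\<close>
  show i1: "integrable half_normal (\<lambda>a. of_real a * f a)"
  proof (rule Bochner_Integration.integrable_bound[OF integrable_mult_right[OF integrable_half_normal_exp[of "3/4"], of "4 * B"]])
    show "AE a in half_normal. norm (of_real a * f a) \<le> norm (4 * B * exp (3/4 * a\<^sup>2))"
    proof (rule AE_I2)
      fix a :: real
      have "0 \<le> (\<bar>a\<bar> - 2)\<^sup>2" by simp
      hence "\<bar>a\<bar> \<le> 4 * (1 + a\<^sup>2 / 4)" by (simp add: power2_eq_square algebra_simps)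
      also have "\<dots> \<le> 4 * exp (a\<^sup>2 / 4)" by (intro mult_left_mono exp_ge_add_one_self) auto
      finally have "\<bar>a\<bar> * norm (f a) \<le> (4 * exp (a\<^sup>2 / 4)) * (B * exp (a\<^sup>2 / 2))"
        using bf by (intro mult_mono) auto
      also have "\<dots> = 4 * B * exp (3/4 * a\<^sup>2)" by (simp add: exp_add[symmetric])
      finally show "norm (of_real a * f a) \<le> norm (4 * B * exp (3/4 * a\<^sup>2))"
        using B by (simp add: norm_mult)
    qed
  qed auto
  define r where "r = normal_density 0 (1 / sqrt 2)"
  define k where "k = 1 / sqrt pi"
  have k: "0 \<le> k" "k \<le> 1" using pi_gt3 by (auto simp: k_def)
  have r: "r a = exp (- a\<^sup>2) * k" for a by (simp add: r_def normal_density_half k_def)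
  have [measurable]: "r \<in> borel_measurable borel" by (simp add: r_def)
  have r0: "r a \<ge> 0" for a using k by (simp add: r)
  have dr: "(r has_real_derivative (- 2 * a * r a)) (at a)" for a
    unfolding r[abs_def] by (auto intro!: derivative_eq_intros)
  have j1: "integrable lborel (\<lambda>a. r a *\<^sub>R (of_real a * f a))"
    using i1 r0 by (subst (asm) integrable_density) (auto simp: r_def[symmetric])
  have j2: "integrable lborel (\<lambda>a. r a *\<^sub>R f' a)"
    using i2 r0 by (subst (asm) integrable_density) (auto simp: r_def[symmetric])
  let ?F = "\<lambda>a. r a *\<^sub>R f a"
  let ?F' = "\<lambda>a. r a *\<^sub>R f' a - 2 *\<^sub>R (r a *\<^sub>R (of_real a * f a))"
  have dF: "(?F has_vector_derivative ?F' a) (at a)" for a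
    by (rule derivative_eq_intros dr[unfolded has_real_derivative_iff_has_vector_derivative] d refl dr)+
       (simp add: scaleR_conv_of_real algebra_simps)
  have cr: "continuous_on UNIV r" unfolding r[abs_def] by (intro continuous_intros)
  have "continuous_on UNIV ?F'" by (intro continuous_intros cr c cf)
  hence cF: "isCont ?F' a" for a by (simp add: continuous_on_eq_continuous_at)
  have iF: "set_integrable lborel (einterval (-\<infinity>) \<infinity>) ?F'"
    unfolding set_integrable_def
    using Bochner_Integration.integrable_diff[OF j2 integrable_scaleR_right[OF j1, of 2]] by (simp add: einterval_def)
  have lim: "((\<lambda>a::real. B * exp (- a\<^sup>2 / 2)) \<longlongrightarrow> 0) F \<Longrightarrow> (?F \<longlongrightarrow> 0) F" for F
  proof (rule Lim_null_comparison[rotated])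
    show "\<forall>\<^sub>F a in F. norm (?F a) \<le> B * exp (- a\<^sup>2 / 2)"
    proof (rule always_eventually, rule allI)
      fix a
      have "norm (?F a) \<le> (exp (-a\<^sup>2) * 1) * (B * exp (a\<^sup>2/2))"
        unfolding norm_scaleR r using k bf[of a] by (intro mult_mono) (auto simp: abs_mult)
      also have "\<dots> = B * exp (- a\<^sup>2 / 2)" by (simp add: exp_add[symmetric])
      finally show "norm (?F a) \<le> B * exp (- a\<^sup>2 / 2)" .
    qed
  qed
  have "(LBINT a=-\<infinity>..\<infinity>. ?F' a) = 0 - 0"
  proof (rule interval_integral_FTC_integrable[where F = ?F])
    show "((?F \<circ> real_of_ereal) \<longlongrightarrow> 0) (at_right (-\<infinity>))"
      unfolding ereal_tendsto_simps by (rule lim) real_asymp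
  next
    show "((?F \<circ> real_of_ereal) \<longlongrightarrow> 0) (at_left \<infinity>)"
      unfolding ereal_tendsto_simps by (rule lim) real_asymp
  qed (use dF cF iF in auto)
  hence h0: "(\<integral>a. ?F' a \<partial>lborel) = 0"
    by (simp add: interval_lebesgue_integral_def set_lebesgue_integral_def einterval_def)
  have h1: "(\<integral>a. ?F' a \<partial>lborel) = (\<integral>a. r a *\<^sub>R f' a \<partial>lborel) - 2 *\<^sub>R (\<integral>a. r a *\<^sub>R (of_real a * f a) \<partial>lborel)"
    unfolding Bochner_Integration.integral_diff[OF j2 integrable_scaleR_right[OF j1, of 2]] integral_scaleR_right ..
  have h2: "(\<integral>a. r a *\<^sub>R f' a \<partial>lborel) = (\<integral>a. f' a \<partial>half_normal)"
    using r0 by (subst integral_density) (auto simp: r_def)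
  have h3: "(\<integral>a. r a *\<^sub>R (of_real a * f a) \<partial>lborel) = (\<integral>a. of_real a * f a \<partial>half_normal)"
    using r0 by (subst integral_density) (auto simp: r_def)
  have "(\<integral>a. f' a \<partial>half_normal) - 2 *\<^sub>R (\<integral>a. of_real a * f a \<partial>half_normal) = 0"
    using h0 unfolding h1 h2 h3 .
  thus "(\<integral>a. of_real a * f a \<partial>half_normal) = (\<integral>a. f' a \<partial>half_normal) / 2"
    by (simp add: scaleR_conv_of_real)
qed

text \<open>Trades a linear factor for an arbitrarily small increase of the Gaussian
  exponent.\<close>

lemma exp_growth_times: "0 < \<epsilon> \<Longrightarrow> \<bar>a\<bar> \<le> (1 + 1 / \<epsilon>) * exp (\<epsilon> * a\<^sup>2)" for a \<epsilon> :: real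
proof -
  assume e: "0 < \<epsilon>"
  have "0 \<le> (\<bar>a\<bar> - 1)\<^sup>2" by simp
  hence "\<bar>a\<bar> \<le> 1 + a\<^sup>2" by (simp add: power2_eq_square algebra_simps)
  also have "\<dots> \<le> (1 + 1 / \<epsilon>) * (1 + \<epsilon> * a\<^sup>2)"
    using e by (simp add: field_simps)
  also have "\<dots> \<le> (1 + 1 / \<epsilon>) * exp (\<epsilon> * a\<^sup>2)"
    using e by (intro mult_left_mono exp_ge_add_one_self) auto
  finally show ?thesis .
qed

section \<open>The complex Gaussian: reduction to two real coordinates and integration by
  parts\<close>

lemma integral_std_complex_gaussian:
  fixes G :: "complex \<Rightarrow> complex"
  assumes [measurable]: "G \<in> borel_measurable borel"
  shows "integrable std_complex_gaussian G \<longleftrightarrow> integrable (half_normal \<Otimes>\<^sub>M half_normal) (\<lambda>(a, b). G (Complex a b))"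
    and "(\<integral>w. G w \<partial>std_complex_gaussian) = (\<integral>(a, b). G (Complex a b) \<partial>(half_normal \<Otimes>\<^sub>M half_normal))"
proof -
  have s: "sets (half_normal \<Otimes>\<^sub>M half_normal) = sets (borel \<Otimes>\<^sub>M borel)"
    by (intro sets_pair_measure_cong) simp_all
  have m: "(\<lambda>(a, b). Complex a b) \<in> borel_measurable (half_normal \<Otimes>\<^sub>M half_normal)"
    using Complex_measurable measurable_cong_sets[OF s refl] by blast
  have c: "(\<lambda>x. G (case x of (a, b) \<Rightarrow> Complex a b)) = (\<lambda>(a, b). G (Complex a b))"
    by (simp add: fun_eq_iff)
  show "integrable std_complex_gaussian G \<longleftrightarrow> integrable (half_normal \<Otimes>\<^sub>M half_normal) (\<lambda>(a, b). G (Complex a b))"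
    unfolding std_complex_gaussian_def integrable_distr_eq[OF m assms] c ..
  show "(\<integral>w. G w \<partial>std_complex_gaussian) = (\<integral>(a, b). G (Complex a b) \<partial>(half_normal \<Otimes>\<^sub>M half_normal))"
    unfolding std_complex_gaussian_def integral_distr[OF m assms] c ..
qed

text \<open>The function factorises over the real and imaginary parts, so Fubini reduces the claim
  to the real case.\<close>

lemma integrable_gaussian_exp:
  assumes "c < 1"
  shows "integrable std_complex_gaussian (\<lambda>w. complex_of_real (exp (c * (cmod w)\<^sup>2)))"
proof (subst integral_std_complex_gaussian)
  interpret N: prob_space half_normal by (rule prob_space_normal_density) simp
  interpret P: pair_prob_space half_normal half_normal ..
  have i: "integrable half_normal (\<lambda>a. complex_of_real (exp (c * a\<^sup>2)))"
    using integrable_half_normal_exp[OF assms] by (rule integrable_of_real)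
  have "integrable (half_normal \<Otimes>\<^sub>M half_normal)
      (\<lambda>(a, b). complex_of_real (exp (c * a\<^sup>2)) * complex_of_real (exp (c * b\<^sup>2)))"
  proof (rule P.Fubini_integrable)
    show "integrable half_normal (\<lambda>a. \<integral>b. norm (case (a, b) of (a, b) \<Rightarrow>
        complex_of_real (exp (c * a\<^sup>2)) * complex_of_real (exp (c * b\<^sup>2))) \<partial>half_normal)"
      using integrable_half_normal_exp[OF assms] by (simp add: norm_mult)
  qed (use i in auto)
  also have "(\<lambda>(a, b). complex_of_real (exp (c * a\<^sup>2)) * complex_of_real (exp (c * b\<^sup>2))) =
      (\<lambda>(a, b). complex_of_real (exp (c * (cmod (Complex a b))\<^sup>2)))"
    by (auto simp: fun_eq_iff cmod_power2 exp_add algebra_simps simp flip: of_real_mult)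
  finally show "integrable (half_normal \<Otimes>\<^sub>M half_normal)
      (\<lambda>(a, b). complex_of_real (exp (c * (cmod (Complex a b))\<^sup>2)))" .
qed measurable

text \<open>On densities, \<open>w * exp (- |w|\<^sup>2)\<close> is minus the derivative of \<open>exp (- |w|\<^sup>2)\<close> with respect to the
  conjugate of \<open>w\<close>; that derivative kills the holomorphic factor \<open>g\<close>.\<close>
lemma gaussian_integration_by_parts:
  fixes g h g' h' :: "complex \<Rightarrow> complex"
  assumes dg: "\<And>w. (g has_field_derivative g' w) (at w)"
    and dh: "\<And>w. (h has_field_derivative h' w) (at w)"
    and cg: "continuous_on UNIV g'" and ch: "continuous_on UNIV h'"
    and b: "\<And>w. cmod (g w) \<le> B * exp ((cmod w)\<^sup>2 / 4)" "\<And>w. cmod (h w) \<le> B * exp ((cmod w)\<^sup>2 / 4)"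
      "\<And>w. cmod (g' w) \<le> B * exp ((cmod w)\<^sup>2 / 4)" "\<And>w. cmod (h' w) \<le> B * exp ((cmod w)\<^sup>2 / 4)"
  shows "(\<integral>w. w * g w * cnj (h w) \<partial>std_complex_gaussian) = (\<integral>w. g w * cnj (h' w) \<partial>std_complex_gaussian)"
proof -
  interpret N: prob_space half_normal by (rule prob_space_normal_density) simp
  interpret P: pair_prob_space half_normal half_normal ..
  have B: "0 \<le> B" using order_trans[OF norm_ge_zero b(1)[of 0]] by simp
  have cg0: "continuous_on UNIV g" "continuous_on UNIV h"
    using DERIV_isCont[OF dg] DERIV_isCont[OF dh] by (auto intro: continuous_at_imp_continuous_on)
  have [measurable]: "g \<in> borel_measurable borel" "h \<in> borel_measurable borel"
     "g' \<in> borel_measurable borel" "h' \<in> borel_measurable borel"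
     "(\<lambda>w. cnj (h w)) \<in> borel_measurable borel" "(\<lambda>w. cnj (h' w)) \<in> borel_measurable borel"
    using cg0 cg ch by (auto intro!: borel_measurable_continuous_onI continuous_on_cnj)
  have bb: "cmod (p w * cnj (r w)) \<le> B\<^sup>2 * exp ((cmod w)\<^sup>2 / 2)"
    if "\<And>w. cmod (p w) \<le> B * exp ((cmod w)\<^sup>2 / 4)" "\<And>w. cmod (r w) \<le> B * exp ((cmod w)\<^sup>2 / 4)" for p r w
  proof -
    have "cmod (p w * cnj (r w)) \<le> (B * exp ((cmod w)\<^sup>2 / 4)) * (B * exp ((cmod w)\<^sup>2 / 4))"
      unfolding norm_mult complex_mod_cnj using that B by (intro mult_mono) auto
    also have "\<dots> = B\<^sup>2 * exp ((cmod w)\<^sup>2 / 2)" by (simp add: power2_eq_square exp_add[symmetric])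
    finally show ?thesis .
  qed
  note bgh = bb[OF b(1,2)] bb[OF b(3,2)] bb[OF b(1,4)]
  \<comment> \<open>Exponent 3/4 is what is needed: a product of two functions of growth 1/4 has
    growth 1/2, and a factor \<open>Re w\<close> or \<open>Im w\<close> is charged another
    1/4.\<close>
  have dom: "integrable std_complex_gaussian G"
    if [measurable]: "G \<in> borel_measurable borel" and le: "\<And>w. cmod (G w) \<le> D * exp (3/4 * (cmod w)\<^sup>2)" for G :: "complex \<Rightarrow> complex" and D
  proof (rule Bochner_Integration.integrable_bound[OF integrable_mult_right[OF integrable_gaussian_exp[of "3/4"], of "complex_of_real D"]])
    show "AE w in std_complex_gaussian. cmod (G w) \<le> cmod (complex_of_real D * complex_of_real (exp (3/4 * (cmod w)\<^sup>2)))"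
    proof (rule AE_I2)
      fix w
      have "cmod (G w) \<le> D * exp (3/4 * (cmod w)\<^sup>2)" by (rule le)
      also have "\<dots> \<le> \<bar>D\<bar> * exp (3/4 * (cmod w)\<^sup>2)" by (intro mult_right_mono) auto
      finally show "cmod (G w) \<le> cmod (complex_of_real D * complex_of_real (exp (3/4 * (cmod w)\<^sup>2)))"
        by (simp add: norm_mult)
    qed
  qed (auto simp: measurable_cong_sets[OF sets_std_complex_gaussian refl])
  let ?G = "\<lambda>w. g w * cnj (h w)"
  have one: "B\<^sup>2 * exp (x / 2) \<le> B\<^sup>2 * exp (3/4 * x)" if "x \<ge> 0" for x
    using that by (intro mult_left_mono) auto
  have lin: "cmod (of_real t * ?G w) \<le> 5 * B\<^sup>2 * exp (3/4 * (cmod w)\<^sup>2)" if "\<bar>t\<bar> \<le> cmod w" for t w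
  proof -
    have "\<bar>t\<bar> \<le> 5 * exp (1/4 * (cmod w)\<^sup>2)" using that exp_growth_times[of "1/4" "cmod w"] by simp
    hence "cmod (of_real t * ?G w) \<le> (5 * exp (1/4 * (cmod w)\<^sup>2)) * (B\<^sup>2 * exp ((cmod w)\<^sup>2 / 2))"
      using bgh(1)[of w] by (subst norm_mult) (intro mult_mono, auto)
    also have "\<dots> = 5 * B\<^sup>2 * exp (3/4 * (cmod w)\<^sup>2)" by (simp add: exp_add[symmetric])
    finally show ?thesis .
  qed
  have iRe: "integrable std_complex_gaussian (\<lambda>w. of_real (Re w) * ?G w)"
    by (rule dom[OF _ lin[OF abs_Re_le_cmod]]) measurable
  have iIm: "integrable std_complex_gaussian (\<lambda>w. of_real (Im w) * ?G w)"
    by (rule dom[OF _ lin[OF abs_Im_le_cmod]]) measurable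
  have i1: "integrable std_complex_gaussian (\<lambda>w. g' w * cnj (h w))"
    by (rule dom[OF _ order_trans[OF bgh(2) one]]) auto
  have i2: "integrable std_complex_gaussian (\<lambda>w. g w * cnj (h' w))"
    by (rule dom[OF _ order_trans[OF bgh(3) one]]) auto
  \<comment> \<open>On a line parallel to an axis the fixed coordinate only contributes the constant
    \<open>exp (s\<^sup>2 / 2)\<close>. The leading 2 leaves room for the two summands of a product
    rule.\<close>
  have slice: "\<exists>D. \<forall>t. 2 * B\<^sup>2 * exp ((cmod (Complex s t))\<^sup>2 / 2) \<le> D * exp (t\<^sup>2 / 2)
       \<and> 2 * B\<^sup>2 * exp ((cmod (Complex t s))\<^sup>2 / 2) \<le> D * exp (t\<^sup>2 / 2)" for s
    by (rule exI[of _ "2 * B\<^sup>2 * exp (s\<^sup>2 / 2)"]) (simp add: cmod_power2 exp_add add_divide_distrib)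
  have hdRe: "((\<lambda>a. f (Complex a s)) has_vector_derivative f' (Complex t s)) (at t)"
    if "\<And>w. (f has_field_derivative f' w) (at w)" for f f' :: "complex \<Rightarrow> complex" and s t
  proof -
    have "((\<lambda>a. Complex a s) has_vector_derivative 1) (at t)"
      unfolding Complex_eq by (auto intro!: derivative_eq_intros)
    from field_vector_diff_chain_at[OF this that] show ?thesis by (simp add: o_def)
  qed
  have hdIm: "((\<lambda>b. f (Complex s b)) has_vector_derivative \<i> * f' (Complex s t)) (at t)"
    if "\<And>w. (f has_field_derivative f' w) (at w)" for f f' :: "complex \<Rightarrow> complex" and s t
  proof -
    have "((\<lambda>b. Complex s b) has_vector_derivative \<i>) (at t)"
      unfolding Complex_eq by (auto intro!: derivative_eq_intros)
    from field_vector_diff_chain_at[OF this that] show ?thesis by (simp add: o_def)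
  qed
  \<comment> \<open>These are the derivatives of \<open>g * cnj h\<close> in the real and in the
    imaginary direction. In \<open>(?H + \<i> * ?K) / 2\<close> the terms with \<open>g'\<close>
    cancel and \<open>g * cnj h'\<close> remains, which is the final identity.\<close>
  let ?H = "\<lambda>w. g' w * cnj (h w) + g w * cnj (h' w)"
  let ?K = "\<lambda>w. \<i> * (g' w * cnj (h w) - g w * cnj (h' w))"
  have bH: "cmod (?H w) \<le> 2 * B\<^sup>2 * exp ((cmod w)\<^sup>2 / 2)" for w
    using norm_triangle_ineq[of "g' w * cnj (h w)" "g w * cnj (h' w)"] bgh(2,3)[of w] by linarith
  have bK: "cmod (?K w) \<le> 2 * B\<^sup>2 * exp ((cmod w)\<^sup>2 / 2)" for w
    using norm_triangle_ineq4[of "g' w * cnj (h w)" "g w * cnj (h' w)"] bgh(2,3)[of w]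
    by (simp add: norm_mult)
  have bG: "cmod (?G w) \<le> 2 * B\<^sup>2 * exp ((cmod w)\<^sup>2 / 2)" for w
    by (rule order_trans[OF bgh(1)]) simp
  have cont: "continuous_on UNIV ?H" "continuous_on UNIV ?K"
    by (intro continuous_intros cg0 cg ch)+
  have ccomp: "continuous_on UNIV (\<lambda>t. f (Complex t s))" "continuous_on UNIV (\<lambda>t. f (Complex s t))"
    if "continuous_on UNIV f" for f :: "complex \<Rightarrow> complex" and s
    unfolding Complex_eq by (auto intro!: continuous_on_compose2[OF that] continuous_intros)
  have re: "(\<integral>a. of_real a * ?G (Complex a s) \<partial>half_normal) = (\<integral>a. ?H (Complex a s) \<partial>half_normal) / 2" for s
  proof -
    obtain D where D: "\<And>t. 2 * B\<^sup>2 * exp ((cmod (Complex t s))\<^sup>2 / 2) \<le> D * exp (t\<^sup>2 / 2)" using slice[of s] by blast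
    show ?thesis
    proof (rule half_normal_integration_by_parts(1)[where B = D])
      show "((\<lambda>a. ?G (Complex a s)) has_vector_derivative ?H (Complex a s)) (at a)" for a
        by (rule derivative_eq_intros has_vector_derivative_cnj hdRe dg dh refl)+ (simp add: algebra_simps)
    qed (use order_trans[OF bG D] order_trans[OF bH D] ccomp[OF cont(1)] in auto)
  qed
  have im: "(\<integral>b. of_real b * ?G (Complex s b) \<partial>half_normal) = (\<integral>b. ?K (Complex s b) \<partial>half_normal) / 2" for s
  proof -
    obtain D where D: "\<And>t. 2 * B\<^sup>2 * exp ((cmod (Complex s t))\<^sup>2 / 2) \<le> D * exp (t\<^sup>2 / 2)" using slice[of s] by blast
    show ?thesis
    proof (rule half_normal_integration_by_parts(1)[where B = D])
      show "((\<lambda>b. ?G (Complex s b)) has_vector_derivative ?K (Complex s b)) (at b)" for b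
        by (rule derivative_eq_intros has_vector_derivative_cnj hdIm dg dh refl)+ (simp add: algebra_simps)
    qed (use order_trans[OF bG D] order_trans[OF bK D] ccomp[OF cont(2)] in auto)
  qed
  have fub1: "(\<integral>w. F w \<partial>std_complex_gaussian) = (\<integral>b. (\<integral>a. F (Complex a b) \<partial>half_normal) \<partial>half_normal)"
    and fub2: "(\<integral>w. F w \<partial>std_complex_gaussian) = (\<integral>a. (\<integral>b. F (Complex a b) \<partial>half_normal) \<partial>half_normal)"
    if m: "F \<in> borel_measurable borel" and i: "integrable std_complex_gaussian F" for F :: "complex \<Rightarrow> complex"
    using P.integral_snd[of "\<lambda>a b. F (Complex a b)"] P.integral_fst[of "\<lambda>a b. F (Complex a b)"] integral_std_complex_gaussian[OF m] i
    by auto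
  have "(\<integral>w. of_real (Re w) * ?G w \<partial>std_complex_gaussian) = (\<integral>b. (\<integral>a. of_real a * ?G (Complex a b) \<partial>half_normal) \<partial>half_normal)"
    by (subst fub1[OF _ iRe]) auto
  also have "\<dots> = (\<integral>b. (\<integral>a. ?H (Complex a b) \<partial>half_normal) \<partial>half_normal) / 2"
    unfolding re by simp
  also have "\<dots> = (\<integral>w. ?H w \<partial>std_complex_gaussian) / 2"
    by (subst fub1[of ?H]) (use i1 i2 in auto)
  finally have A1: "(\<integral>w. of_real (Re w) * ?G w \<partial>std_complex_gaussian) = (\<integral>w. ?H w \<partial>std_complex_gaussian) / 2" .
  have "(\<integral>w. of_real (Im w) * ?G w \<partial>std_complex_gaussian) = (\<integral>a. (\<integral>b. of_real b * ?G (Complex a b) \<partial>half_normal) \<partial>half_normal)"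
    by (subst fub2[OF _ iIm]) auto
  also have "\<dots> = (\<integral>a. (\<integral>b. ?K (Complex a b) \<partial>half_normal) \<partial>half_normal) / 2"
    unfolding im by simp
  also have "\<dots> = (\<integral>w. ?K w \<partial>std_complex_gaussian) / 2"
    by (subst fub2[of ?K]) (use i1 i2 in auto)
  finally have A2: "(\<integral>w. of_real (Im w) * ?G w \<partial>std_complex_gaussian) = (\<integral>w. ?K w \<partial>std_complex_gaussian) / 2" .
  have e: "w * g w * cnj (h w) = of_real (Re w) * ?G w + \<i> * (of_real (Im w) * ?G w)" for w
    by (subst (1) complex_eq) (simp add: algebra_simps)
  have "(\<integral>w. w * g w * cnj (h w) \<partial>std_complex_gaussian) =
     (\<integral>w. of_real (Re w) * ?G w \<partial>std_complex_gaussian) + \<i> * (\<integral>w. of_real (Im w) * ?G w \<partial>std_complex_gaussian)"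
    unfolding e using iRe iIm by (subst Bochner_Integration.integral_add) auto
  also have "\<dots> = (\<integral>w. g w * cnj (h' w) \<partial>std_complex_gaussian)"
    unfolding A1 A2 using i1 i2 by (simp add: field_simps)
  finally show ?thesis .
qed

section \<open>Matchings avoiding a set of vertices\<close>

text \<open>The sum type keeps the two sides of the bipartition apart: \<open>Inl i\<close> is a row
  vertex and \<open>Inr j\<close> a column vertex.\<close>

definition ends :: "nat \<times> nat \<Rightarrow> (nat + nat) set" where
  "ends e = {Inl (fst e), Inr (snd e)}"

text \<open>For an edge \<open>e\<close> this is the closed neighbourhood in the line graph:
  \<open>e\<close> itself belongs to it, which accounts for the squares in
  \<open>L2\<close>.\<close>

definition nbhd :: "nat \<Rightarrow> nat \<times> nat \<Rightarrow> (nat \<times> nat) set" where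
  "nbhd n e = {f \<in> edges n. ends e \<inter> ends f \<noteq> {}}"

definition matchings_avoiding :: "nat \<Rightarrow> (nat + nat) set \<Rightarrow> (nat \<times> nat) set set" where
  "matchings_avoiding n S = {M \<in> matchings n. \<forall>f\<in>M. ends f \<inter> S = {}}"

definition Z_avoiding :: "nat \<Rightarrow> (nat + nat) set \<Rightarrow> (nat \<times> nat \<Rightarrow> complex) \<Rightarrow> complex" where
  "Z_avoiding n S x = (\<Sum>M\<in>matchings_avoiding n S. \<Prod>e\<in>M. x e)"

definition nbhd_sum :: "nat \<Rightarrow> nat \<times> nat \<Rightarrow> (nat \<times> nat \<Rightarrow> complex) \<Rightarrow> complex" where
  "nbhd_sum n e x = (\<Sum>f\<in>nbhd n e. x f)"

text \<open>\<open>L1 + L2\<close> rewritten over closed neighbourhoods; in this form its derivative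
  in the variable of \<open>e\<close> is simply \<open>1 - nbhd_sum n e\<close>.\<close>

definition L12 :: "nat \<Rightarrow> (nat \<times> nat \<Rightarrow> complex) \<Rightarrow> complex" where
  "L12 n x = (\<Sum>e\<in>edges n. x e) - (1 / 2) * (\<Sum>e\<in>edges n. x e * nbhd_sum n e x)"

definition incident_avoiding :: "nat \<Rightarrow> (nat + nat) set \<Rightarrow> nat + nat \<Rightarrow> (nat \<times> nat) set" where
  "incident_avoiding n S v = {f \<in> edges n. v \<in> ends f \<and> ends f \<inter> S = {}}"

lemma finite_edges [simp, intro]: "finite (edges n)" and card_edges: "card (edges n) = n\<^sup>2"
  by (simp_all add: edges_def power2_eq_square)

lemma finite_nbhd [simp, intro]: "finite (nbhd n e)"
  and finite_incident_avoiding [simp, intro]: "finite (incident_avoiding n S v)"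
  by (simp_all add: nbhd_def incident_avoiding_def)

lemma card_incident_avoiding: "card (incident_avoiding n S v) \<le> n"
proof -
  let ?h = "\<lambda>k. case v of Inl i \<Rightarrow> (i, k) | Inr j \<Rightarrow> (k, j)"
  have "incident_avoiding n S v \<subseteq> ?h ` {1..n}"
    by (auto simp: incident_avoiding_def ends_def edges_def image_iff)
  hence "card (incident_avoiding n S v) \<le> card (?h ` {1..n})" by (rule card_mono[rotated]) simp
  also have "\<dots> \<le> n" using card_image_le[of "{1..n}" ?h] by simp
  finally show ?thesis .
qed

lemma card_nbhd: "card (nbhd n e) \<le> 2 * n"
proof -
  have "nbhd n e \<subseteq> incident_avoiding n {} (Inl (fst e)) \<union> incident_avoiding n {} (Inr (snd e))"
    by (auto simp: nbhd_def incident_avoiding_def ends_def)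
  hence "card (nbhd n e) \<le> card (incident_avoiding n {} (Inl (fst e)) \<union> incident_avoiding n {} (Inr (snd e)))"
    by (rule card_mono[rotated]) simp
  also have "\<dots> \<le> n + n"
    by (rule order_trans[OF card_Un_le]) (intro add_mono card_incident_avoiding)
  finally show ?thesis by simp
qed

lemma nbhd_commute: "f \<in> edges n \<Longrightarrow> e \<in> edges n \<Longrightarrow> f \<in> nbhd n e \<longleftrightarrow> e \<in> nbhd n f"
  by (auto simp: nbhd_def)

lemma nbhd_subset: "nbhd n e \<subseteq> edges n"
  by (auto simp: nbhd_def)

lemma nbhd_edge: "f \<in> nbhd n e \<Longrightarrow> f \<in> edges n"
  by (simp add: nbhd_def)

lemma adjacent_iff: "adjacent e f \<longleftrightarrow> e \<noteq> f \<and> ends e \<inter> ends f \<noteq> {}"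
  by (auto simp: adjacent_def ends_def)

lemma ends_nonempty: "ends e \<noteq> {}"
  by (simp add: ends_def)

lemma finite_matchings [simp]: "finite (matchings n)"
  by (rule finite_subset[of _ "Pow (edges n)"]) (auto simp: matchings_def)

lemma finite_matchings_avoiding [simp]: "finite (matchings_avoiding n S)"
  by (simp add: matchings_avoiding_def)

lemma matchings_avoiding_subset: "M \<in> matchings_avoiding n S \<Longrightarrow> M \<subseteq> edges n"
  by (auto simp: matchings_avoiding_def matchings_def)

lemma matchings_avoidingD:
  "M \<in> matchings_avoiding n S \<Longrightarrow> e \<in> M \<Longrightarrow> f \<in> M \<Longrightarrow> e \<noteq> f \<Longrightarrow> ends e \<inter> ends f = {}"
  "M \<in> matchings_avoiding n S \<Longrightarrow> e \<in> M \<Longrightarrow> ends e \<inter> S = {}"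
  by (auto simp: matchings_avoiding_def matchings_def adjacent_iff)

lemma Z_eq: "Z n x = Z_avoiding n {} x"
  by (simp add: Z_def Z_avoiding_def matchings_avoiding_def)

text \<open>Every unordered adjacent pair comes from exactly two ordered ones, and each edge is its
  own neighbour once. Halving the neighbourhood sum therefore leaves half of each square and each
  pair once.\<close>

lemma L12_eq: "L12 n x = L1 n x + L2 n x"
proof -
  define A where "A = {(e, f). e \<in> edges n \<and> f \<in> edges n \<and> adjacent e f}"
  have fA: "finite A"
    by (rule finite_subset[of _ "edges n \<times> edges n"]) (auto simp: A_def)
  let ?h = "\<lambda>(e, f). {e, f}"
  have im: "?h ` A = adjacent_pairs n"
    by (auto simp: A_def adjacent_pairs_def image_iff)
  have "(\<Sum>(e, f)\<in>A. x e * x f) = (\<Sum>P\<in>?h ` A. \<Sum>p\<in>{p \<in> A. ?h p = P}. (case p of (e, f) \<Rightarrow> x e * x f))"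
    by (rule sum.image_gen[OF fA])
  also have "\<dots> = (\<Sum>P\<in>adjacent_pairs n. 2 * (\<Prod>e\<in>P. x e))"
    unfolding im
  proof (rule sum.cong[OF refl])
    fix P assume "P \<in> adjacent_pairs n"
    then obtain e f where P: "P = {e, f}" "e \<in> edges n" "f \<in> edges n" "adjacent e f"
      by (auto simp: adjacent_pairs_def)
    have ne: "e \<noteq> f" and "adjacent f e" using P by (auto simp: adjacent_def)
    hence "{p \<in> A. ?h p = P} = {(e, f), (f, e)}"
      using P by (auto simp: A_def doubleton_eq_iff)
    thus "(\<Sum>p\<in>{p \<in> A. ?h p = P}. (case p of (e, f) \<Rightarrow> x e * x f)) = 2 * (\<Prod>e\<in>P. x e)"
      using ne P by simp
  qed
  finally have 1: "(\<Sum>(e, f)\<in>A. x e * x f) = 2 * (\<Sum>P\<in>adjacent_pairs n. \<Prod>e\<in>P. x e)"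
    by (simp add: sum_distrib_left)
  have "(\<Sum>e\<in>edges n. x e * nbhd_sum n e x) = (\<Sum>e\<in>edges n. (x e)\<^sup>2 + (\<Sum>f\<in>nbhd n e - {e}. x e * x f))"
  proof (rule sum.cong[OF refl])
    fix e assume "e \<in> edges n"
    hence "e \<in> nbhd n e" by (auto simp: nbhd_def ends_def)
    hence "nbhd_sum n e x = x e + (\<Sum>f\<in>nbhd n e - {e}. x f)"
      unfolding nbhd_sum_def by (subst sum.remove[of _ e]) auto
    thus "x e * nbhd_sum n e x = (x e)\<^sup>2 + (\<Sum>f\<in>nbhd n e - {e}. x e * x f)"
      by (simp add: algebra_simps power2_eq_square sum_distrib_left)
  qed
  also have "\<dots> = (\<Sum>e\<in>edges n. (x e)\<^sup>2) + (\<Sum>e\<in>edges n. \<Sum>f\<in>nbhd n e - {e}. x e * x f)"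
    by (simp add: sum.distrib)
  also have "(\<Sum>e\<in>edges n. \<Sum>f\<in>nbhd n e - {e}. x e * x f) = (\<Sum>(e, f)\<in>Sigma (edges n) (\<lambda>e. nbhd n e - {e}). x e * x f)"
    by (subst sum.Sigma) auto
  also have "Sigma (edges n) (\<lambda>e. nbhd n e - {e}) = A"
    by (auto simp: A_def nbhd_def adjacent_iff)
  finally have 2: "(\<Sum>e\<in>edges n. x e * nbhd_sum n e x) =
      (\<Sum>e\<in>edges n. (x e)\<^sup>2) + (\<Sum>(e, f)\<in>A. x e * x f)" .
  show ?thesis
    unfolding L12_def L1_def L2_def 2 1 by (simp add: algebra_simps)
qed

section \<open>Expansion of the matching polynomial along an edge and along a vertex\<close>

lemma matchings_avoiding_containing:
  assumes "e \<in> edges n" "ends e \<inter> S = {}"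
  shows "{M \<in> matchings_avoiding n S. e \<in> M} = insert e ` matchings_avoiding n (S \<union> ends e)"
proof (intro subset_antisym subsetI)
  fix M assume "M \<in> {M \<in> matchings_avoiding n S. e \<in> M}"
  hence M: "M \<in> matchings_avoiding n S" "e \<in> M" by auto
  hence "M \<in> matchings n" by (simp add: matchings_avoiding_def)
  hence "M - {e} \<in> matchings n" by (auto simp: matchings_def)
  moreover have "ends f \<inter> (S \<union> ends e) = {}" if "f \<in> M - {e}" for f
    using matchings_avoidingD[OF M(1), of f] that M(2) by blast
  ultimately have "M - {e} \<in> matchings_avoiding n (S \<union> ends e)"
    by (simp add: matchings_avoiding_def)
  moreover have "M = insert e (M - {e})" using M(2) by blast
  ultimately show "M \<in> insert e ` matchings_avoiding n (S \<union> ends e)" by (rule image_eqI[rotated])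
next
  fix M assume "M \<in> insert e ` matchings_avoiding n (S \<union> ends e)"
  then obtain M' where M: "M = insert e M'" "M' \<in> matchings_avoiding n (S \<union> ends e)" by auto
  thus "M \<in> {M \<in> matchings_avoiding n S. e \<in> M}"
    using assms by (auto simp: matchings_avoiding_def matchings_def adjacent_iff)
qed

lemma sum_matchings_containing:
  assumes "e \<in> edges n" "ends e \<inter> S = {}"
  shows "(\<Sum>M\<in>{M \<in> matchings_avoiding n S. e \<in> M}. \<Prod>f\<in>M. x f) = x e * Z_avoiding n (S \<union> ends e) x"
proof -
  have notin: "e \<notin> M" if "M \<in> matchings_avoiding n (S \<union> ends e)" for M
    using matchings_avoidingD(2)[OF that] ends_nonempty[of e] by blast
  have fin: "finite M" if "M \<in> matchings_avoiding n (S \<union> ends e)" for M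
    using matchings_avoiding_subset[OF that] finite_subset by blast
  have "inj_on (insert e) (matchings_avoiding n (S \<union> ends e))"
    using notin by (intro inj_onI) (metis insert_ident)
  thus ?thesis
    unfolding matchings_avoiding_containing[OF assms] Z_avoiding_def
    by (subst sum.reindex) (auto simp: notin fin sum_distrib_left intro!: sum.cong)
qed

text \<open>Separates the part free of \<open>x e\<close> from the part linear in it, so that the
  partial derivative can be read off.\<close>

lemma Z_avoiding_edge:
  assumes "e \<in> edges n" "ends e \<inter> S = {}"
  shows "Z_avoiding n S x =
    (\<Sum>M\<in>{M \<in> matchings_avoiding n S. e \<notin> M}. \<Prod>f\<in>M. x f) + x e * Z_avoiding n (S \<union> ends e) x"
proof -
  have "Z_avoiding n S x = (\<Sum>M\<in>matchings_avoiding n S \<inter> {M. e \<in> M}. \<Prod>f\<in>M. x f)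
      + (\<Sum>M\<in>matchings_avoiding n S - {M. e \<in> M}. \<Prod>f\<in>M. x f)"
    unfolding Z_avoiding_def by (rule sum.Int_Diff) simp
  moreover have "matchings_avoiding n S \<inter> {M. e \<in> M} = {M \<in> matchings_avoiding n S. e \<in> M}"
    "matchings_avoiding n S - {M. e \<in> M} = {M \<in> matchings_avoiding n S. e \<notin> M}" by blast+
  ultimately show ?thesis
    by (simp only: sum_matchings_containing[OF assms] add.commute)
qed

text \<open>A matching either leaves \<open>v\<close> uncovered or covers it by exactly one edge
  \<open>f\<close>. The classes for distinct \<open>f\<close> are disjoint, since two edges at
  \<open>v\<close> never lie in a common matching.\<close>

lemma Z_avoiding_vertex:
  assumes "v \<notin> S"
  shows "Z_avoiding n S x = Z_avoiding n (insert v S) x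
     + (\<Sum>f\<in>incident_avoiding n S v. x f * Z_avoiding n (S \<union> ends f) x)"
proof -
  let ?C = "\<lambda>f. {M \<in> matchings_avoiding n S. f \<in> M}"
  have eq: "matchings_avoiding n S = matchings_avoiding n (insert v S) \<union> (\<Union>f\<in>incident_avoiding n S v. ?C f)"
  proof (intro subset_antisym subsetI)
    fix M assume M: "M \<in> matchings_avoiding n S"
    show "M \<in> matchings_avoiding n (insert v S) \<union> (\<Union>f\<in>incident_avoiding n S v. ?C f)"
    proof (cases "\<exists>f\<in>M. v \<in> ends f")
      case True
      then obtain f where f: "f \<in> M" "v \<in> ends f" by blast
      hence "f \<in> incident_avoiding n S v"
        using matchings_avoidingD(2)[OF M f(1)] matchings_avoiding_subset[OF M] by (auto simp: incident_avoiding_def)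
      thus ?thesis using M f by blast
    next
      case False
      thus ?thesis using M by (auto simp: matchings_avoiding_def)
    qed
  qed (auto simp: matchings_avoiding_def)
  have d: "matchings_avoiding n (insert v S) \<inter> (\<Union>f\<in>incident_avoiding n S v. ?C f) = {}"
    by (auto simp: matchings_avoiding_def incident_avoiding_def)
  have dd: "?C f \<inter> ?C g = {}" if "f \<in> incident_avoiding n S v" "g \<in> incident_avoiding n S v" "f \<noteq> g" for f g
  proof (rule ccontr)
    assume "?C f \<inter> ?C g \<noteq> {}"
    then obtain M where M: "M \<in> matchings_avoiding n S" "f \<in> M" "g \<in> M" by blast
    have "ends f \<inter> ends g = {}" using matchings_avoidingD(1)[OF M that(3)] .
    thus False using that(1,2) by (auto simp: incident_avoiding_def)
  qed
  have "Z_avoiding n S x = Z_avoiding n (insert v S) x + (\<Sum>M\<in>(\<Union>f\<in>incident_avoiding n S v. ?C f). \<Prod>e\<in>M. x e)"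
    unfolding Z_avoiding_def by (subst eq, subst sum.union_disjoint) (use d in auto)
  also have "(\<Sum>M\<in>(\<Union>f\<in>incident_avoiding n S v. ?C f). \<Prod>e\<in>M. x e) = (\<Sum>f\<in>incident_avoiding n S v. \<Sum>M\<in>?C f. \<Prod>e\<in>M. x e)"
    using dd by (intro sum.UNION_disjoint) auto
  also have "\<dots> = (\<Sum>f\<in>incident_avoiding n S v. x f * Z_avoiding n (S \<union> ends f) x)"
    by (intro sum.cong refl sum_matchings_containing) (auto simp: incident_avoiding_def)
  finally show ?thesis .
qed

section \<open>Partial derivatives and admissible functions\<close>

definition has_partial :: "nat \<times> nat \<Rightarrow> ((nat \<times> nat \<Rightarrow> complex) \<Rightarrow> complex) \<Rightarrow> ((nat \<times> nat \<Rightarrow> complex) \<Rightarrow> complex) \<Rightarrow> bool" where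
  "has_partial e g g' \<longleftrightarrow> (\<forall>x. ((\<lambda>w. g (x(e := w))) has_field_derivative g' x) (at (x e)))"

text \<open>Total through \<open>deriv\<close>; the value is meaningful once
  \<open>has_partial\<close> is known.\<close>

definition pd :: "nat \<times> nat \<Rightarrow> ((nat \<times> nat \<Rightarrow> complex) \<Rightarrow> complex) \<Rightarrow> ((nat \<times> nat \<Rightarrow> complex) \<Rightarrow> complex)" where
  "pd e g x = deriv (\<lambda>w. g (x(e := w))) (x e)"

lemma pd_eq: "has_partial e g g' \<Longrightarrow> pd e g = g'"
  by (auto simp: has_partial_def pd_def fun_eq_iff intro: DERIV_imp_deriv)

lemma has_partial_at:
  assumes "has_partial e g g'"
  shows "((\<lambda>w. g (x(e := w))) has_field_derivative g' (x(e := w))) (at w)"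
  using assms[unfolded has_partial_def, rule_format, of "x(e := w)"] by simp

lemma has_partial_const: "has_partial e (\<lambda>x. c) (\<lambda>x. 0)"
  and has_partial_coord: "has_partial e (\<lambda>x. x f) (\<lambda>x. if f = e then 1 else 0)"
  by (auto simp: has_partial_def)

lemma has_partial_add:
  "has_partial e g g' \<Longrightarrow> has_partial e h h' \<Longrightarrow> has_partial e (\<lambda>x. g x + h x) (\<lambda>x. g' x + h' x)"
  unfolding has_partial_def by (auto intro!: derivative_eq_intros)

lemma has_partial_mult:
  "has_partial e g g' \<Longrightarrow> has_partial e h h' \<Longrightarrow> has_partial e (\<lambda>x. g x * h x) (\<lambda>x. g' x * h x + g x * h' x)"
  unfolding has_partial_def by (auto intro!: derivative_eq_intros)

lemma has_partial_exp: "has_partial e g g' \<Longrightarrow> has_partial e (\<lambda>x. exp (g x)) (\<lambda>x. g' x * exp (g x))"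
  unfolding has_partial_def by (auto intro!: derivative_eq_intros)

lemma has_partial_sum:
  "(\<And>i. i \<in> I \<Longrightarrow> has_partial e (g i) (g' i)) \<Longrightarrow> has_partial e (\<lambda>x. \<Sum>i\<in>I. g i x) (\<lambda>x. \<Sum>i\<in>I. g' i x)"
  unfolding has_partial_def by (auto intro!: DERIV_sum)

text \<open>If \<open>e\<close> meets the deleted set, no remaining matching uses \<open>e\<close>
  and the polynomial is constant in that variable. Otherwise it is affine in it, with the slope
  given by the edge expansion.\<close>

lemma has_partial_Z_avoiding:
  assumes "e \<in> edges n"
  shows "has_partial e (Z_avoiding n S) (\<lambda>x. if ends e \<inter> S = {} then Z_avoiding n (S \<union> ends e) x else 0)"
proof -
  have indep: "(\<Prod>f\<in>M. (x(e := w)) f) = (\<Prod>f\<in>M. x f)" if "e \<notin> M" for M w and x :: "nat \<times> nat \<Rightarrow> complex"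
    using that by (intro prod.cong) auto
  have Zindep: "Z_avoiding n T (x(e := w)) = Z_avoiding n T x" if "ends e \<inter> T \<noteq> {}" for T x w
    unfolding Z_avoiding_def using that by (intro sum.cong refl indep) (auto simp: matchings_avoiding_def)
  show ?thesis
  proof (cases "ends e \<inter> S = {}")
    case True
    have "has_partial e (\<lambda>x. (\<Sum>M\<in>{M \<in> matchings_avoiding n S. e \<notin> M}. \<Prod>f\<in>M. x f)
        + x e * Z_avoiding n (S \<union> ends e) x) (\<lambda>x. 0 + ((if e = e then 1 else 0) * Z_avoiding n (S \<union> ends e) x + x e * 0))"
    proof (intro has_partial_add has_partial_mult has_partial_coord)
      show "has_partial e (\<lambda>x. \<Sum>M\<in>{M \<in> matchings_avoiding n S. e \<notin> M}. \<Prod>f\<in>M. x f) (\<lambda>x. 0)"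
      proof -
        have "(\<Sum>M\<in>{M \<in> matchings_avoiding n S. e \<notin> M}. \<Prod>f\<in>M. (x(e := w)) f) =
            (\<Sum>M\<in>{M \<in> matchings_avoiding n S. e \<notin> M}. \<Prod>f\<in>M. x f)" for x :: "nat \<times> nat \<Rightarrow> complex" and w
          by (intro sum.cong refl indep) auto
        thus ?thesis by (simp only: has_partial_def) simp
      qed
      show "has_partial e (Z_avoiding n (S \<union> ends e)) (\<lambda>x. 0)"
        unfolding has_partial_def using ends_nonempty by (subst Zindep) auto
    qed
    moreover have "Z_avoiding n S = (\<lambda>x. (\<Sum>M\<in>{M \<in> matchings_avoiding n S. e \<notin> M}. \<Prod>f\<in>M. x f)
        + x e * Z_avoiding n (S \<union> ends e) x)"
      by (rule ext) (rule Z_avoiding_edge[OF assms True])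
    ultimately show ?thesis using True by simp
  next
    case False
    thus ?thesis by (simp add: has_partial_def Zindep)
  qed
qed

text \<open>By \<open>nbhd_commute\<close> the quadratic form is symmetric, so both terms of the
  product rule yield the same \<open>nbhd_sum\<close>, and this cancels the factor 1/2.\<close>

lemma has_partial_L12:
  assumes "e \<in> edges n"
  shows "has_partial e (L12 n) (\<lambda>x. 1 - nbhd_sum n e x)"
proof -
  let ?d = "\<lambda>f. if f = e then 1 else 0 :: complex"
  have "has_partial e (\<lambda>x. (\<Sum>f\<in>edges n. x f) + (- 1 / 2) * (\<Sum>f\<in>edges n. x f * (\<Sum>h\<in>nbhd n f. x h)))
     (\<lambda>x. (\<Sum>f\<in>edges n. ?d f) + (0 * (\<Sum>f\<in>edges n. x f * (\<Sum>h\<in>nbhd n f. x h))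
        + (- 1 / 2) * (\<Sum>f\<in>edges n. ?d f * (\<Sum>h\<in>nbhd n f. x h) + x f * (\<Sum>h\<in>nbhd n f. ?d h))))"
    by (intro has_partial_add has_partial_mult has_partial_sum has_partial_coord has_partial_const)
  moreover have "(\<Sum>f\<in>edges n. x f * (\<Sum>h\<in>nbhd n f. ?d h)) = nbhd_sum n e x" for x
  proof -
    have "(\<Sum>f\<in>edges n. x f * (\<Sum>h\<in>nbhd n f. ?d h)) = (\<Sum>f\<in>edges n. if f \<in> nbhd n e then x f else 0)"
      using assms by (intro sum.cong refl) (auto simp: sum.delta' nbhd_commute)
    also have "\<dots> = nbhd_sum n e x"
      unfolding nbhd_sum_def using nbhd_subset[of n e] by (subst sum.inter_restrict[symmetric]) (auto simp: Int_absorb1)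
    finally show ?thesis .
  qed
  moreover have "(\<Sum>f\<in>edges n. ?d f * (\<Sum>h\<in>nbhd n f. x h)) = nbhd_sum n e x" for x
    using assms by (simp add: nbhd_sum_def if_distrib[of "\<lambda>c. c * _"] sum.delta cong: if_cong)
  moreover have "(\<Sum>f\<in>edges n. ?d f) = 1" using assms by (simp add: sum.delta)
  ultimately show ?thesis
    by (simp add: L12_def[abs_def] nbhd_sum_def[symmetric] sum.distrib)
qed

text \<open>The functions \<open>p * exp (- L12)\<close> with \<open>p\<close> a polynomial in the edge variables.\<close>
inductive admissible :: "nat \<Rightarrow> ((nat \<times> nat \<Rightarrow> complex) \<Rightarrow> complex) \<Rightarrow> bool" for n where
  exp: "admissible n (\<lambda>x. exp (- L12 n x))"
| coord: "admissible n g \<Longrightarrow> e \<in> edges n \<Longrightarrow> admissible n (\<lambda>x. x e * g x)"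
| scale: "admissible n g \<Longrightarrow> admissible n (\<lambda>x. c * g x)"
| add: "admissible n g \<Longrightarrow> admissible n h \<Longrightarrow> admissible n (\<lambda>x. g x + h x)"

lemma admissible_zero: "admissible n (\<lambda>x. 0)"
  using admissible.scale[OF admissible.exp, of n 0] by simp

lemma admissible_diff: "admissible n g \<Longrightarrow> admissible n h \<Longrightarrow> admissible n (\<lambda>x. g x - h x)"
  using admissible.add[OF _ admissible.scale[of n h "-1"], of g] by simp

lemma admissible_sum: "(\<And>i. i \<in> I \<Longrightarrow> admissible n (g i)) \<Longrightarrow> admissible n (\<lambda>x. \<Sum>i\<in>I. g i x)"
  by (induction I rule: infinite_finite_induct) (auto intro: admissible_zero admissible.add)

lemma admissible_prod:
  assumes "admissible n g" "M \<subseteq> edges n"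
  shows "admissible n (\<lambda>x. (\<Prod>e\<in>M. x e) * g x)"
proof -
  have "finite M" using assms(2) finite_subset by blast
  thus ?thesis using assms(2)
  proof (induction M rule: finite_induct)
    case (insert e M)
    thus ?case using admissible.coord[of n "\<lambda>x. (\<Prod>e\<in>M. x e) * g x" e] by (simp add: mult.assoc)
  qed (use assms(1) in simp)
qed

section \<open>Weighted matching polynomials and closure under differentiation\<close>

definition weighted_Z :: "nat \<Rightarrow> (nat + nat) set \<Rightarrow> (nat \<times> nat \<Rightarrow> complex) \<Rightarrow> complex" where
  "weighted_Z n S x = Z_avoiding n S x * exp (- L12 n x)"

lemma admissible_weighted_Z: "admissible n (weighted_Z n S)"
  unfolding weighted_Z_def[abs_def] Z_avoiding_def sum_distrib_right
  by (intro admissible_sum admissible_prod admissible.exp matchings_avoiding_subset)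

lemma admissible_nbhd_sum: "admissible n g \<Longrightarrow> admissible n (\<lambda>x. nbhd_sum n e x * g x)"
  unfolding nbhd_sum_def sum_distrib_right by (intro admissible_sum admissible.coord nbhd_edge)

lemma has_partial_exp_L12:
  assumes "e \<in> edges n"
  shows "has_partial e (\<lambda>x. exp (- L12 n x)) (\<lambda>x. - exp (- L12 n x) + nbhd_sum n e x * exp (- L12 n x))"
proof -
  have "has_partial e (\<lambda>x. exp ((-1) * L12 n x)) (\<lambda>x. (0 * L12 n x + (-1) * (1 - nbhd_sum n e x)) * exp ((-1) * L12 n x))"
    by (intro has_partial_exp has_partial_mult has_partial_const has_partial_L12 assms)
  thus ?thesis by (simp add: algebra_simps)
qed

text \<open>Closure under differentiation allows integration by parts to be applied repeatedly
  without leaving the class.\<close>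

lemma admissible_has_partial:
  assumes "admissible n g" "e \<in> edges n"
  shows "\<exists>g'. admissible n g' \<and> has_partial e g g'"
  using assms(1)
proof induction
  case exp
  have "admissible n (\<lambda>x. - exp (- L12 n x) + nbhd_sum n e x * exp (- L12 n x))"
    using admissible.add[OF admissible.scale[OF admissible.exp, of n "-1"] admissible_nbhd_sum[OF admissible.exp]] by simp
  thus ?case using has_partial_exp_L12[OF assms(2)] by blast
next
  case (coord g f)
  then obtain g' where g': "admissible n g'" "has_partial e g g'" by blast
  have "has_partial e (\<lambda>x. x f * g x) (\<lambda>x. (if f = e then 1 else 0) * g x + x f * g' x)"
    by (intro has_partial_mult has_partial_coord g')
  moreover have "admissible n (\<lambda>x. (if f = e then 1 else 0) * g x + x f * g' x)"
    by (intro admissible.intros coord g')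
  ultimately show ?case by blast
next
  case (scale g c)
  then obtain g' where g': "admissible n g'" "has_partial e g g'" by blast
  have "has_partial e (\<lambda>x. c * g x) (\<lambda>x. 0 * g x + c * g' x)"
    by (intro has_partial_mult has_partial_const g')
  thus ?case using admissible.scale[OF g'(1), of c] by auto
next
  case (add g h)
  thus ?case using has_partial_add admissible.add by blast
qed

lemma
  assumes "admissible n g" "e \<in> edges n"
  shows admissible_pd: "admissible n (pd e g)" and has_partial_pd: "has_partial e g (pd e g)"
proof -
  obtain g' where g': "admissible n g'" "has_partial e g g'" using admissible_has_partial[OF assms] by blast
  show "admissible n (pd e g)" "has_partial e g (pd e g)" using g' by (simp_all add: pd_eq[OF g'(2)])
qed

lemma pd_weighted_Z:
  assumes "e \<in> edges n"
  shows "pd e (weighted_Z n S) = (\<lambda>x. (if ends e \<inter> S = {} then weighted_Z n (S \<union> ends e) x else 0) - weighted_Z n S x + nbhd_sum n e x * weighted_Z n S x)"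
  using pd_eq[OF has_partial_mult[OF has_partial_Z_avoiding[OF assms, of S] has_partial_exp_L12[OF assms]]]
  unfolding weighted_Z_def[abs_def] by (auto simp: fun_eq_iff algebra_simps)

lemma weighted_Z_vertex:
  assumes "v \<notin> S"
  shows "weighted_Z n S x = weighted_Z n (insert v S) x + (\<Sum>f\<in>incident_avoiding n S v. x f * weighted_Z n (S \<union> ends f) x)"
  unfolding weighted_Z_def Z_avoiding_vertex[OF assms] by (simp add: algebra_simps sum_distrib_left)

lemma F2_eq_weighted_Z: "F2 n = weighted_Z n {}"
  by (simp add: F2_def weighted_Z_def Z_eq L12_eq fun_eq_iff algebra_simps)

section \<open>Measurability, restriction to rays, and growth of admissible functions\<close>

lemma admissible_measurable:
  assumes "admissible n g" "\<And>e. e \<in> edges n \<Longrightarrow> (\<lambda>\<omega>. y \<omega> e) \<in> borel_measurable M"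
  shows "(\<lambda>\<omega>. g (y \<omega>)) \<in> borel_measurable M"
  using assms(1)
proof induction
  case exp
  have "(\<lambda>\<omega>. L12 n (y \<omega>)) \<in> borel_measurable M"
    unfolding L12_def nbhd_sum_def using nbhd_subset
    by (intro borel_measurable_diff borel_measurable_times borel_measurable_sum borel_measurable_const assms(2)) auto
  thus ?case by measurable
next
  case (coord g e)
  thus ?case using assms(2)[of e] by simp
qed auto

text \<open>The chain rule along a ray, obtained by induction on the construction of
  \<open>g\<close>, without passing through joint differentiability.\<close>

lemma admissible_ray:
  assumes "admissible n g"
  shows "((\<lambda>s::real. g (\<lambda>e. of_real s * y e)) has_vector_derivative
     (\<Sum>e\<in>edges n. y e * pd e g (\<lambda>e. of_real s * y e))) (at s)"
  using assms
proof induction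
  case exp
  \<comment> \<open>On the ray \<open>L12\<close> is a quadratic polynomial in \<open>s\<close>,
    with leading coefficient \<open>- Q / 2\<close>.\<close>
  define Q where "Q = (\<Sum>e\<in>edges n. y e * nbhd_sum n e y)"
  have n: "nbhd_sum n e (\<lambda>e. of_real s * y e) = of_real s * nbhd_sum n e y" for e s
    by (simp add: nbhd_sum_def sum_distrib_left)
  have L: "L12 n (\<lambda>e. of_real s * y e) = of_real s * (\<Sum>e\<in>edges n. y e) - (of_real s)\<^sup>2 / 2 * Q" for s
    unfolding L12_def n Q_def by (simp add: sum_distrib_left algebra_simps power2_eq_square)
  have "(\<Sum>e\<in>edges n. y e * pd e (\<lambda>x. exp (- L12 n x)) (\<lambda>e. of_real s * y e)) =
     (\<Sum>e\<in>edges n. (of_real s * (y e * nbhd_sum n e y) - y e) * exp (- L12 n (\<lambda>e. of_real s * y e)))"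
    by (intro sum.cong refl, subst pd_eq[OF has_partial_exp_L12]) (simp_all add: n algebra_simps)
  also have "\<dots> = (of_real s * Q - (\<Sum>e\<in>edges n. y e)) * exp (- L12 n (\<lambda>e. of_real s * y e))"
    by (simp add: sum_distrib_right[symmetric] sum_subtractf sum_distrib_left Q_def)
  finally have e: "(\<Sum>e\<in>edges n. y e * pd e (\<lambda>x. exp (- L12 n x)) (\<lambda>e. of_real s * y e)) =
     (of_real s * Q - (\<Sum>e\<in>edges n. y e)) * exp (- L12 n (\<lambda>e. of_real s * y e))" .
  have "((\<lambda>w. exp (- (w * (\<Sum>e\<in>edges n. y e) - w\<^sup>2 / 2 * Q))) has_field_derivative
     (w * Q - (\<Sum>e\<in>edges n. y e)) * exp (- (w * (\<Sum>e\<in>edges n. y e) - w\<^sup>2 / 2 * Q))) (at w)" for w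
    by (auto intro!: derivative_eq_intros)
  from has_vector_derivative_real_field[OF this] show ?case unfolding e L .
next
  case (coord g f)
  have "pd e (\<lambda>x. x f * g x) = (\<lambda>x. (if f = e then 1 else 0) * g x + x f * pd e g x)" if "e \<in> edges n" for e
    by (intro pd_eq has_partial_mult has_partial_coord has_partial_pd[OF coord(1) that])
  hence "(\<Sum>e\<in>edges n. y e * pd e (\<lambda>x. x f * g x) (\<lambda>e. of_real s * y e)) =
     (\<Sum>e\<in>edges n. (if f = e then y e * g (\<lambda>e. of_real s * y e) else 0) + of_real s * y f * (y e * pd e g (\<lambda>e. of_real s * y e)))"
    by (intro sum.cong refl) (auto simp: algebra_simps)
  also have "\<dots> = y f * g (\<lambda>e. of_real s * y e) + of_real s * y f * (\<Sum>e\<in>edges n. y e * pd e g (\<lambda>e. of_real s * y e))"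
    using coord(2) by (simp add: sum.distrib sum_distrib_left)
  finally have e: "(\<Sum>e\<in>edges n. y e * pd e (\<lambda>x. x f * g x) (\<lambda>e. of_real s * y e)) = 
     y f * g (\<lambda>e. of_real s * y e) + of_real s * y f * (\<Sum>e\<in>edges n. y e * pd e g (\<lambda>e. of_real s * y e))" .
  have d: "((\<lambda>s. of_real s * y f) has_vector_derivative y f) (at s)"
    by (auto intro!: derivative_eq_intros)
  show ?case unfolding e
    by (rule has_vector_derivative_eq_rhs[OF has_vector_derivative_mult[OF d coord.IH]]) (simp add: algebra_simps)
next
  case (scale g c)
  have "pd e (\<lambda>x. c * g x) = (\<lambda>x. 0 * g x + c * pd e g x)" if "e \<in> edges n" for e
    by (intro pd_eq has_partial_mult has_partial_const has_partial_pd[OF scale(1) that])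
  hence e: "(\<Sum>e\<in>edges n. y e * pd e (\<lambda>x. c * g x) (\<lambda>e. of_real s * y e)) =
     c * (\<Sum>e\<in>edges n. y e * pd e g (\<lambda>e. of_real s * y e))"
    by (simp add: sum_distrib_left algebra_simps cong: sum.cong)
  show ?case unfolding e by (rule has_vector_derivative_mult_right[OF scale.IH])
next
  case (add g h)
  have "pd e (\<lambda>x. g x + h x) = (\<lambda>x. pd e g x + pd e h x)" if "e \<in> edges n" for e
    by (intro pd_eq has_partial_add has_partial_pd[OF add(1) that] has_partial_pd[OF add(2) that])
  hence e: "(\<Sum>e\<in>edges n. y e * pd e (\<lambda>x. g x + h x) (\<lambda>e. of_real s * y e)) =
     (\<Sum>e\<in>edges n. y e * pd e g (\<lambda>e. of_real s * y e)) + (\<Sum>e\<in>edges n. y e * pd e h (\<lambda>e. of_real s * y e))"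
    by (simp add: sum.distrib algebra_simps cong: sum.cong)
  show ?case unfolding e by (rule has_vector_derivative_add[OF add.IH])
qed

text \<open>A closed neighbourhood has at most \<open>2 * n\<close> edges, so the quadratic part of
  \<open>L12\<close> costs \<open>n\<close> in the exponent; the linear part costs 1 and a constant.
  The strict inequality leaves slack that pays for polynomial factors.\<close>

lemma admissible_growth:
  assumes "admissible n g" "\<kappa> > real n + 1"
  shows "\<exists>A\<ge>0. \<forall>x. cmod (g x) \<le> A * exp (\<kappa> * (\<Sum>e\<in>edges n. (cmod (x e))\<^sup>2))"
  using assms
proof (induction arbitrary: \<kappa>)
  case exp
  have "cmod (exp (- L12 n x)) \<le> exp (real (card (edges n))) * exp (\<kappa> * (\<Sum>e\<in>edges n. (cmod (x e))\<^sup>2))" for x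
  proof -
    define s where "s = (\<Sum>e\<in>edges n. (cmod (x e))\<^sup>2)"
    have s0: "0 \<le> s" by (simp add: s_def sum_nonneg)
    have "cmod (\<Sum>e\<in>edges n. x e) \<le> (\<Sum>e\<in>edges n. cmod (x e))" by (rule norm_sum)
    also have "\<dots> \<le> (\<Sum>e\<in>edges n. 1 + (cmod (x e))\<^sup>2)"
    proof (rule sum_mono)
      fix e
      have "0 \<le> (cmod (x e) - 1)\<^sup>2" by simp
      thus "cmod (x e) \<le> 1 + (cmod (x e))\<^sup>2"
        using norm_ge_zero[of "x e"] unfolding power2_diff power_one by linarith
    qed
    also have "\<dots> = real (card (edges n)) + s" by (simp add: sum.distrib s_def)
    finally have 1: "cmod (\<Sum>e\<in>edges n. x e) \<le> real (card (edges n)) + s" .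
    have "cmod (\<Sum>e\<in>edges n. x e * nbhd_sum n e x) \<le> (\<Sum>e\<in>edges n. cmod (x e * nbhd_sum n e x))" by (rule norm_sum)
    also have "\<dots> \<le> (\<Sum>e\<in>edges n. \<Sum>f\<in>nbhd n e. (cmod (x e))\<^sup>2 / 2 + (cmod (x f))\<^sup>2 / 2)"
    proof (rule sum_mono)
      fix e
      have "cmod (x e * nbhd_sum n e x) \<le> (\<Sum>f\<in>nbhd n e. cmod (x e * x f))"
        unfolding nbhd_sum_def sum_distrib_left by (rule norm_sum)
      also have "\<dots> \<le> (\<Sum>f\<in>nbhd n e. (cmod (x e))\<^sup>2 / 2 + (cmod (x f))\<^sup>2 / 2)"
      proof (rule sum_mono)
        fix f
        have "0 \<le> (cmod (x e) - cmod (x f))\<^sup>2" by simp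
        thus "cmod (x e * x f) \<le> (cmod (x e))\<^sup>2 / 2 + (cmod (x f))\<^sup>2 / 2"
          unfolding norm_mult power2_diff by simp
      qed
      finally show "cmod (x e * nbhd_sum n e x) \<le> (\<Sum>f\<in>nbhd n e. (cmod (x e))\<^sup>2 / 2 + (cmod (x f))\<^sup>2 / 2)" .
    qed
    also have "\<dots> = (\<Sum>e\<in>edges n. \<Sum>f\<in>nbhd n e. (cmod (x e))\<^sup>2 / 2) + (\<Sum>e\<in>edges n. \<Sum>f\<in>nbhd n e. (cmod (x f))\<^sup>2 / 2)"
      by (simp add: sum.distrib)
    \<comment> \<open>Being neighbours is a symmetric relation, so the second half-sum has the same
      shape as the first.\<close>
    also have "(\<Sum>e\<in>edges n. \<Sum>f\<in>nbhd n e. (cmod (x f))\<^sup>2 / 2) = (\<Sum>f\<in>edges n. \<Sum>e\<in>nbhd n f. (cmod (x f))\<^sup>2 / 2)"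
      unfolding nbhd_def by (subst sum.swap_restrict) (auto simp: Int_commute)
    also have "(\<Sum>e\<in>edges n. \<Sum>f\<in>nbhd n e. (cmod (x e))\<^sup>2 / 2) \<le> real n * s"
      unfolding s_def sum_distrib_left
    proof (rule sum_mono)
      fix e
      have "real (card (nbhd n e)) * ((cmod (x e))\<^sup>2 / 2) \<le> (2 * real n) * ((cmod (x e))\<^sup>2 / 2)"
        using card_nbhd[of n e] by (intro mult_right_mono) (auto simp flip: of_nat_mult)
      thus "(\<Sum>f\<in>nbhd n e. (cmod (x e))\<^sup>2 / 2) \<le> real n * (cmod (x e))\<^sup>2" by simp
    qed
    finally have 2: "cmod (\<Sum>e\<in>edges n. x e * nbhd_sum n e x) \<le> 2 * (real n * s)" by (simp add: mult_ac)
    have "cmod (L12 n x) \<le> cmod (\<Sum>e\<in>edges n. x e) + cmod ((1 / 2) * (\<Sum>e\<in>edges n. x e * nbhd_sum n e x))"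
      unfolding L12_def by (rule norm_triangle_ineq4)
    also have "\<dots> \<le> real (card (edges n)) + s + real n * s" using 1 2 by (simp add: norm_mult)
    also have "\<dots> = real (card (edges n)) + (real n + 1) * s" by (simp add: algebra_simps)
    also have "\<dots> \<le> real (card (edges n)) + \<kappa> * s"
      using exp s0 by (intro add_left_mono mult_right_mono) auto
    finally have "cmod (L12 n x) \<le> real (card (edges n)) + \<kappa> * s" .
    hence "exp (cmod (- L12 n x)) \<le> exp (real (card (edges n)) + \<kappa> * s)" by simp
    thus ?thesis unfolding s_def[symmetric] exp_add using norm_exp[of "- L12 n x"] by linarith
  qed
  thus ?case by (intro exI[of _ "exp (real (card (edges n)))"]) auto
next
  case (coord g e)
  \<comment> \<open>The midpoint between the threshold and \<kappa>: the induction hypothesis is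
    used at \<open>k\<close>, and the remaining \<open>\<kappa> - k\<close> absorbs the factor
    \<open>x e\<close>.\<close>
  define k where "k = (\<kappa> + (real n + 1)) / 2"
  have k: "real n + 1 < k" "0 < \<kappa> - k" using coord.prems by (auto simp: k_def)
  from coord.IH[OF k(1)] obtain A where A: "A \<ge> 0" "\<And>x. cmod (g x) \<le> A * exp (k * (\<Sum>e\<in>edges n. (cmod (x e))\<^sup>2))" by blast
  have "cmod (x e * g x) \<le> (1 + 1 / (\<kappa> - k)) * A * exp (\<kappa> * (\<Sum>e\<in>edges n. (cmod (x e))\<^sup>2))" for x
  proof -
    define s where "s = (\<Sum>e\<in>edges n. (cmod (x e))\<^sup>2)"
    have "(cmod (x e))\<^sup>2 \<le> s" unfolding s_def by (rule member_le_sum) (use coord in auto)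
    hence "(\<kappa> - k) * (cmod (x e))\<^sup>2 \<le> (\<kappa> - k) * s" using k by (intro mult_left_mono) auto
    hence "(1 + 1 / (\<kappa> - k)) * exp ((\<kappa> - k) * (cmod (x e))\<^sup>2) \<le> (1 + 1 / (\<kappa> - k)) * exp ((\<kappa> - k) * s)"
      using k(2) by (intro mult_left_mono) auto
    hence "cmod (x e) \<le> (1 + 1 / (\<kappa> - k)) * exp ((\<kappa> - k) * s)"
      using exp_growth_times[OF k(2), of "cmod (x e)"] unfolding abs_norm_cancel by linarith
    hence "cmod (x e) * cmod (g x) \<le> ((1 + 1 / (\<kappa> - k)) * exp ((\<kappa> - k) * s)) * (A * exp (k * s))"
      using A(2)[of x] k unfolding s_def[symmetric] by (intro mult_mono) auto
    also have "\<dots> = (1 + 1 / (\<kappa> - k)) * A * exp (\<kappa> * s)"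
      by (simp add: mult_ac flip: exp_add) (simp add: algebra_simps flip: exp_add)
    finally show ?thesis by (simp add: norm_mult s_def)
  qed
  thus ?case using k A(1) by (intro exI[of _ "(1 + 1 / (\<kappa> - k)) * A"]) auto
next
  case (scale g c)
  from scale.IH[OF scale.prems] obtain A where A: "A \<ge> 0" "\<And>x. cmod (g x) \<le> A * exp (\<kappa> * (\<Sum>e\<in>edges n. (cmod (x e))\<^sup>2))" by blast
  show ?case
    by (rule exI[of _ "cmod c * A"]) (use A in \<open>auto simp: norm_mult mult.assoc intro!: mult_left_mono\<close>)
next
  case (add g h)
  from add.IH(1)[OF add.prems] obtain A where A: "A \<ge> 0" "\<And>x. cmod (g x) \<le> A * exp (\<kappa> * (\<Sum>e\<in>edges n. (cmod (x e))\<^sup>2))" by blast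
  from add.IH(2)[OF add.prems] obtain C where C: "C \<ge> 0" "\<And>x. cmod (h x) \<le> C * exp (\<kappa> * (\<Sum>e\<in>edges n. (cmod (x e))\<^sup>2))" by blast
  show ?case
    by (rule exI[of _ "A + C"])
      (use A(1) C(1) in \<open>auto simp: distrib_right intro!: order_trans[OF norm_triangle_ineq add_mono[OF A(2) C(2)]]\<close>)
qed

section \<open>Norm estimates\<close>

text \<open>For \<open>n \<ge> 1\<close> the growth rate \<open>n + 2\<close> is at most
  \<open>3 * n\<close>, and scaling by \<open>z\<close> brings it down to
  \<open>3 / 12 = 1 / 4\<close>. With this exponent a product of two such functions and a coordinate
  stays integrable. The constant \<open>A\<close> is uniform in \<open>z\<close>, as needed for
  varying the scale.\<close>

lemma admissible_gaussian_growth: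
  assumes "admissible n g" "n \<ge> 1"
  shows "\<exists>A\<ge>0. \<forall>z W. real n * (cmod z)\<^sup>2 \<le> 1 / 12 \<longrightarrow>
    cmod (g (\<lambda>e. z * W e)) \<le> A * exp (1 / 4 * (\<Sum>e\<in>edges n. (cmod (W e))\<^sup>2))"
proof -
  obtain A where A: "A \<ge> 0" "\<And>x. cmod (g x) \<le> A * exp ((real n + 2) * (\<Sum>e\<in>edges n. (cmod (x e))\<^sup>2))"
    using admissible_growth[OF assms(1), of "real n + 2"] by auto
  have "cmod (g (\<lambda>e. z * W e)) \<le> A * exp (1 / 4 * (\<Sum>e\<in>edges n. (cmod (W e))\<^sup>2))"
    if z: "real n * (cmod z)\<^sup>2 \<le> 1 / 12" for z W
  proof -
    have "(real n + 2) * (cmod z)\<^sup>2 \<le> (3 * real n) * (cmod z)\<^sup>2"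
      using assms(2) by (intro mult_right_mono) auto
    hence q: "(real n + 2) * (cmod z)\<^sup>2 \<le> 1 / 4" using z by simp
    have "(real n + 2) * (\<Sum>e\<in>edges n. (cmod (z * W e))\<^sup>2) = ((real n + 2) * (cmod z)\<^sup>2) * (\<Sum>e\<in>edges n. (cmod (W e))\<^sup>2)"
      by (simp add: norm_mult power_mult_distrib sum_distrib_left mult.assoc)
    also have "\<dots> \<le> 1 / 4 * (\<Sum>e\<in>edges n. (cmod (W e))\<^sup>2)"
      using q by (intro mult_right_mono sum_nonneg) auto
    finally have "exp ((real n + 2) * (\<Sum>e\<in>edges n. (cmod (z * W e))\<^sup>2)) \<le> exp (1 / 4 * (\<Sum>e\<in>edges n. (cmod (W e))\<^sup>2))"
      by simp
    hence "A * exp ((real n + 2) * (\<Sum>e\<in>edges n. (cmod (z * W e))\<^sup>2)) \<le> A * exp (1 / 4 * (\<Sum>e\<in>edges n. (cmod (W e))\<^sup>2))"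
      using A(1) by (rule mult_left_mono)
    thus ?thesis using A(2)[of "\<lambda>e. z * W e"] by linarith
  qed
  thus ?thesis using A(1) by blast
qed

section \<open>Inner products and squared norms under the Gaussian matrix law\<close>

interpretation gaussian: product_sigma_finite "\<lambda>_ :: nat \<times> nat. std_complex_gaussian"
  by (simp add: product_sigma_finite_def prob_space_imp_sigma_finite prob_space_std_complex_gaussian)

lemma integrable_gaussian_matrix_exp:
  assumes "c < 1"
  shows "integrable (gaussian_matrix n) (\<lambda>W. exp (c * (\<Sum>e\<in>edges n. (cmod (W e))\<^sup>2)))"
proof -
  have "integrable std_complex_gaussian (\<lambda>w. exp (c * (cmod w)\<^sup>2))"
    using integrable_norm[OF integrable_gaussian_exp[OF assms]] by simp
  hence "integrable (gaussian_matrix n) (\<lambda>W. \<Prod>e\<in>edges n. exp (c * (cmod (W e))\<^sup>2))"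
    unfolding gaussian_matrix_def by (intro gaussian.product_integrable_prod) auto
  thus ?thesis by (simp add: exp_sum sum_distrib_left)
qed

lemma measurable_gaussian_coord: "e \<in> edges n \<Longrightarrow> (\<lambda>W. z * W e) \<in> borel_measurable (gaussian_matrix n)"
proof -
  assume "e \<in> edges n"
  hence "(\<lambda>W. W e) \<in> measurable (gaussian_matrix n) std_complex_gaussian"
    unfolding gaussian_matrix_def by (rule measurable_component_singleton)
  hence "(\<lambda>W. W e) \<in> borel_measurable (gaussian_matrix n)"
    using measurable_cong_sets[OF refl sets_std_complex_gaussian] by blast
  thus ?thesis by simp
qed

lemma admissible_measurable_gaussian:
  "admissible n g \<Longrightarrow> (\<lambda>W. g (\<lambda>e. z * W e)) \<in> borel_measurable (gaussian_matrix n)"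
  by (rule admissible_measurable) (auto intro: measurable_gaussian_coord)

definition ip where
  "ip n z g h = (\<integral>W. g (\<lambda>e. z * W e) * cnj (h (\<lambda>e. z * W e)) \<partial>gaussian_matrix n)"

text \<open>This is the squared L2 norm. The scale \<open>z\<close> stays an explicit argument
  because it is varied at the end.\<close>

definition nrm where
  "nrm n z g = (\<integral>W. (cmod (g (\<lambda>e. z * W e)))\<^sup>2 \<partial>gaussian_matrix n)"

lemma nrm_nonneg: "0 \<le> nrm n z g"
  unfolding nrm_def by simp

lemma cnj_ip: "cnj (ip n z g h) = ip n z h g"
  unfolding ip_def by (subst Bochner_Integration.integral_cnj[symmetric]) (simp add: mult.commute)

text \<open>The bound \<open>1 / 100\<close> lies below the \<open>1 / 12\<close> that gives
  integrability, and is small enough for the error terms of the deletion estimates to be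
  absorbed.\<close>

locale gaussian_scale =
  fixes n :: nat and z :: complex
  assumes n_pos: "n \<ge> 1" and z_small: "real n * (cmod z)\<^sup>2 \<le> 1 / 100"
begin

lemma growth:
  assumes "admissible n g"
  obtains A where "A \<ge> 0" "\<And>W. cmod (g (\<lambda>e. z * W e)) \<le> A * exp (1 / 4 * (\<Sum>e\<in>edges n. (cmod (W e))\<^sup>2))"
  using admissible_gaussian_growth[OF assms n_pos] z_small by force

lemma integrable_ip:
  assumes "admissible n g" "admissible n h"
  shows "integrable (gaussian_matrix n) (\<lambda>W. g (\<lambda>e. z * W e) * cnj (h (\<lambda>e. z * W e)))"
proof -
  obtain A where A: "A \<ge> 0" "\<And>W. cmod (g (\<lambda>e. z * W e)) \<le> A * exp (1 / 4 * (\<Sum>e\<in>edges n. (cmod (W e))\<^sup>2))"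
    using growth[OF assms(1)] by blast
  obtain B where B: "B \<ge> 0" "\<And>W. cmod (h (\<lambda>e. z * W e)) \<le> B * exp (1 / 4 * (\<Sum>e\<in>edges n. (cmod (W e))\<^sup>2))"
    using growth[OF assms(2)] by blast
  show ?thesis
  proof (rule Bochner_Integration.integrable_bound[OF integrable_mult_right[OF integrable_gaussian_matrix_exp[of "1/2" n], of "A * B"]])
    have "cnj \<in> borel_measurable borel" by (intro borel_measurable_continuous_onI continuous_intros)
    from measurable_compose[OF admissible_measurable_gaussian[OF assms(2)] this]
    show "(\<lambda>W. g (\<lambda>e. z * W e) * cnj (h (\<lambda>e. z * W e))) \<in> borel_measurable (gaussian_matrix n)"
      by (rule borel_measurable_times[OF admissible_measurable_gaussian[OF assms(1)]])
    show "AE W in gaussian_matrix n. norm (g (\<lambda>e. z * W e) * cnj (h (\<lambda>e. z * W e)))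
         \<le> norm (A * B * exp (1 / 2 * (\<Sum>e\<in>edges n. (cmod (W e))\<^sup>2)))"
    proof (rule AE_I2)
      fix W
      define t where "t = (\<Sum>e\<in>edges n. (cmod (W e))\<^sup>2)"
      have "norm (g (\<lambda>e. z * W e) * cnj (h (\<lambda>e. z * W e))) \<le> (A * exp (1/4 * t)) * (B * exp (1/4 * t))"
        unfolding norm_mult complex_mod_cnj using A B unfolding t_def by (intro mult_mono) auto
      also have "\<dots> = A * B * (exp (1/4 * t) * exp (1/4 * t))" by simp
      also have "exp (1/4 * t) * exp (1/4 * t) = exp (1/2 * t)" by (simp flip: exp_add)
      finally show "norm (g (\<lambda>e. z * W e) * cnj (h (\<lambda>e. z * W e)))
         \<le> norm (A * B * exp (1 / 2 * (\<Sum>e\<in>edges n. (cmod (W e))\<^sup>2)))" using A B by (simp add: t_def)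
    qed
  qed simp
qed

lemma integrable_nrm:
  assumes "admissible n g"
  shows "integrable (gaussian_matrix n) (\<lambda>W. (cmod (g (\<lambda>e. z * W e)))\<^sup>2)"
  using integrable_norm[OF integrable_ip[OF assms assms]] by (simp add: norm_mult power2_eq_square)

lemma ip_self: "ip n z g g = of_real (nrm n z g)"
  unfolding ip_def nrm_def complex_norm_square[symmetric] of_real_power[symmetric]
  by (rule integral_complex_of_real)

lemma ip_add_right:
  "admissible n g \<Longrightarrow> admissible n h \<Longrightarrow> admissible n k \<Longrightarrow> ip n z g (\<lambda>x. h x + k x) = ip n z g h + ip n z g k"
  unfolding ip_def using integrable_ip by (simp add: distrib_left)

lemma ip_sum_left:
  "(\<And>i. i \<in> I \<Longrightarrow> admissible n (g i)) \<Longrightarrow> admissible n h \<Longrightarrow>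
    ip n z (\<lambda>x. \<Sum>i\<in>I. g i x) h = (\<Sum>i\<in>I. ip n z (g i) h)"
  unfolding ip_def using integrable_ip by (simp add: sum_distrib_right)

lemma ip_sum_right:
  "(\<And>i. i \<in> I \<Longrightarrow> admissible n (g i)) \<Longrightarrow> admissible n h \<Longrightarrow>
    ip n z h (\<lambda>x. \<Sum>i\<in>I. g i x) = (\<Sum>i\<in>I. ip n z h (g i))"
  unfolding ip_def using integrable_ip by (simp add: sum_distrib_left)

lemma Re_ip_le:
  assumes "admissible n g" "admissible n h"
  shows "Re (ip n z g h) \<le> (nrm n z g + nrm n z h) / 2"
proof -
  have "Re (ip n z g h) = (\<integral>W. Re (g (\<lambda>e. z * W e) * cnj (h (\<lambda>e. z * W e))) \<partial>gaussian_matrix n)"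
    unfolding ip_def using integral_Re[OF integrable_ip[OF assms]] by simp
  also have "\<dots> \<le> (\<integral>W. ((cmod (g (\<lambda>e. z * W e)))\<^sup>2 + (cmod (h (\<lambda>e. z * W e)))\<^sup>2) / 2 \<partial>gaussian_matrix n)"
  proof (rule integral_mono)
    show "integrable (gaussian_matrix n) (\<lambda>W. Re (g (\<lambda>e. z * W e) * cnj (h (\<lambda>e. z * W e))))"
      by (rule integrable_Re[OF integrable_ip[OF assms]])
    show "integrable (gaussian_matrix n) (\<lambda>W. ((cmod (g (\<lambda>e. z * W e)))\<^sup>2 + (cmod (h (\<lambda>e. z * W e)))\<^sup>2) / 2)"
      using integrable_nrm assms by (intro integrable_divide Bochner_Integration.integrable_add) auto
    fix W
    let ?a = "g (\<lambda>e. z * W e)" and ?b = "h (\<lambda>e. z * W e)"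
    have "Re (?a * cnj ?b) \<le> cmod ?a * cmod ?b"
      using complex_Re_le_cmod[of "?a * cnj ?b"] by (simp add: norm_mult)
    moreover have "0 \<le> (cmod ?a - cmod ?b)\<^sup>2" by simp
    ultimately show "Re (?a * cnj ?b) \<le> ((cmod ?a)\<^sup>2 + (cmod ?b)\<^sup>2) / 2"
      unfolding power2_diff by simp
  qed
  also have "\<dots> = (nrm n z g + nrm n z h) / 2"
    unfolding nrm_def using integrable_nrm assms by simp
  finally show ?thesis .
qed

lemma nrm_le:
  assumes "admissible n f" "admissible n g" "admissible n h" "admissible n k"
    and "\<And>x. (cmod (f x))\<^sup>2 \<le> a * (cmod (g x))\<^sup>2 + b * (cmod (h x))\<^sup>2 + c * (cmod (k x))\<^sup>2"
  shows "nrm n z f \<le> a * nrm n z g + b * nrm n z h + c * nrm n z k"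
proof -
  note i = integrable_nrm[OF assms(1)] integrable_nrm[OF assms(2)] integrable_nrm[OF assms(3)] integrable_nrm[OF assms(4)]
  have "nrm n z f \<le> (\<integral>W. a * (cmod (g (\<lambda>e. z * W e)))\<^sup>2 + b * (cmod (h (\<lambda>e. z * W e)))\<^sup>2
       + c * (cmod (k (\<lambda>e. z * W e)))\<^sup>2 \<partial>gaussian_matrix n)"
    unfolding nrm_def using i by (intro integral_mono assms(5)) auto
  also have "\<dots> = a * nrm n z g + b * nrm n z h + c * nrm n z k"
    unfolding nrm_def using i by simp
  finally show ?thesis .
qed

section \<open>Multiplication by a coordinate as the adjoint of differentiation\<close>

lemma slice_growth:
  assumes "admissible n g" "e \<in> edges n"
  shows "\<exists>A. \<forall>w. cmod (g ((\<lambda>f. z * X f)(e := z * w))) \<le> A * exp ((cmod w)\<^sup>2 / 4)"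
proof -
  obtain A where A: "A \<ge> 0" "\<And>W. cmod (g (\<lambda>f. z * W f)) \<le> A * exp (1 / 4 * (\<Sum>f\<in>edges n. (cmod (W f))\<^sup>2))"
    using growth[OF assms(1)] by blast
  have "cmod (g ((\<lambda>f. z * X f)(e := z * w))) \<le> (A * exp (1 / 4 * (\<Sum>f\<in>edges n - {e}. (cmod (X f))\<^sup>2))) * exp ((cmod w)\<^sup>2 / 4)" for w
  proof -
    have "(\<Sum>f\<in>edges n. (cmod ((X(e := w)) f))\<^sup>2) = (cmod w)\<^sup>2 + (\<Sum>f\<in>edges n - {e}. (cmod (X f))\<^sup>2)"
      by (subst sum.remove[OF _ assms(2)]) auto
    moreover have "(\<lambda>f. z * (X(e := w)) f) = (\<lambda>f. z * X f)(e := z * w)" by (auto simp: fun_eq_iff)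
    ultimately show ?thesis using A(2)[of "X(e := w)"] by (simp add: exp_add mult_ac distrib_left)
  qed
  thus ?thesis by blast
qed

text \<open>Fubini isolates the entry \<open>e\<close>, where complex integration by parts applies.
  One factor \<open>z\<close> comes from \<open>x e = z * w\<close>, and \<open>cnj z\<close> from
  the chain rule for the slice of \<open>h\<close>; together they give the squared modulus.\<close>

lemma ip_coord:
  assumes g: "admissible n g" and h: "admissible n h" and e: "e \<in> edges n"
  shows "ip n z (\<lambda>x. x e * g x) h = of_real ((cmod z)\<^sup>2) * ip n z g (pd e h)"
proof -
  define I where "I = edges n - {e}"
  have I: "finite I" "e \<notin> I" "edges n = insert e I" using e by (auto simp: I_def)
  have up: "(\<lambda>f. z * (X(e := w)) f) = (\<lambda>f. z * X f)(e := z * w)" for X w by (auto simp: fun_eq_iff)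
  have fub: "ip n z k l = (\<integral>X. (\<integral>w. k ((\<lambda>f. z * X f)(e := z * w)) * cnj (l ((\<lambda>f. z * X f)(e := z * w))) \<partial>std_complex_gaussian)
       \<partial>Pi\<^sub>M I (\<lambda>_. std_complex_gaussian))" if "admissible n k" "admissible n l" for k l
    unfolding ip_def up[symmetric] gaussian_matrix_def I(3)
    by (rule gaussian.product_integral_insert[OF I(1,2)])
       (use integrable_ip[OF that] in \<open>simp add: gaussian_matrix_def I(3)\<close>)
  have pg: "admissible n (pd e g)" "admissible n (pd e h)" using admissible_pd assms by auto
  have inner: "(\<integral>w. (\<lambda>x. x e * g x) ((\<lambda>f. z * X f)(e := z * w)) * cnj (h ((\<lambda>f. z * X f)(e := z * w))) \<partial>std_complex_gaussian)
     = of_real ((cmod z)\<^sup>2) * (\<integral>w. g ((\<lambda>f. z * X f)(e := z * w)) * cnj (pd e h ((\<lambda>f. z * X f)(e := z * w))) \<partial>std_complex_gaussian)" for X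
  proof -
    let ?s = "\<lambda>k w. k ((\<lambda>f. z * X f)(e := z * w))"
    have deriv: "(?s k has_field_derivative z * ?s (pd e k) w) (at w)" if "admissible n k" for k w
    proof -
      have "((\<lambda>w. z * w) has_field_derivative z) (at w)" by (auto intro!: derivative_eq_intros)
      from DERIV_chain2[OF has_partial_at[OF has_partial_pd[OF that e]] this] show ?thesis
        by (simp add: mult.commute)
    qed
    have cont: "continuous_on UNIV (?s k)" if "admissible n k" for k
      using DERIV_isCont[OF deriv[OF that]] by (auto intro: continuous_at_imp_continuous_on)
    obtain A1 A2 A3 A4 where A: "\<And>w. cmod (?s g w) \<le> A1 * exp ((cmod w)\<^sup>2 / 4)" "\<And>w. cmod (?s h w) \<le> A2 * exp ((cmod w)\<^sup>2 / 4)"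
      "\<And>w. cmod (?s (pd e g) w) \<le> A3 * exp ((cmod w)\<^sup>2 / 4)" "\<And>w. cmod (?s (pd e h) w) \<le> A4 * exp ((cmod w)\<^sup>2 / 4)"
      using slice_growth[OF g e, of X] slice_growth[OF h e, of X] slice_growth[OF pg(1) e, of X] slice_growth[OF pg(2) e, of X]
      by blast
    define B where "B = \<bar>A1\<bar> + \<bar>A2\<bar> + \<bar>cmod z * A3\<bar> + \<bar>cmod z * A4\<bar>"
    have w: "a \<le> B * exp t" if "a \<le> A * exp t" "A \<le> B" for a A t :: real
      by (rule order_trans[OF that(1) mult_right_mono[OF that(2)]]) simp
    have wz: "cmod (z * a) \<le> cmod z * A * exp t" if "cmod a \<le> A * exp t" for a A t
      using mult_left_mono[OF that, of "cmod z"] by (simp add: norm_mult mult.assoc)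
    have "(\<integral>w. w * ?s g w * cnj (?s h w) \<partial>std_complex_gaussian) = (\<integral>w. ?s g w * cnj (z * ?s (pd e h) w) \<partial>std_complex_gaussian)"
    proof (rule gaussian_integration_by_parts[where B = B and g' = "\<lambda>w. z * ?s (pd e g) w"])
      show "continuous_on UNIV (\<lambda>w. z * ?s (pd e g) w)" "continuous_on UNIV (\<lambda>w. z * ?s (pd e h) w)"
        by (intro continuous_intros cont pg)+
      show "cmod (?s g w) \<le> B * exp ((cmod w)\<^sup>2 / 4)" for w by (rule w[OF A(1)]) (simp add: B_def)
      show "cmod (?s h w) \<le> B * exp ((cmod w)\<^sup>2 / 4)" for w by (rule w[OF A(2)]) (simp add: B_def)
      show "cmod (z * ?s (pd e g) w) \<le> B * exp ((cmod w)\<^sup>2 / 4)" for w by (rule w[OF wz[OF A(3)]]) (simp add: B_def)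
      show "cmod (z * ?s (pd e h) w) \<le> B * exp ((cmod w)\<^sup>2 / 4)" for w by (rule w[OF wz[OF A(4)]]) (simp add: B_def)
    qed (use deriv g h in auto)
    hence "z * (\<integral>w. w * ?s g w * cnj (?s h w) \<partial>std_complex_gaussian) = z * (cnj z * (\<integral>w. ?s g w * cnj (?s (pd e h) w) \<partial>std_complex_gaussian))"
      by (simp add: mult.left_commute)
    thus ?thesis
      unfolding complex_norm_square by (simp add: mult.assoc del: mult_cancel_left)
  qed
  show ?thesis
    unfolding fub[OF admissible.coord[OF g e] h] fub[OF g pg(2)] inner by simp
qed

text \<open>A first use of \<open>ip_coord\<close> moves \<open>x f\<close> onto the sum
  \<open>G\<close>, whose derivative has a diagonal part \<open>v f\<close> and a part still
  carrying coordinates \<open>x f'\<close>. A second use moves those onto \<open>v f\<close>,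
  leaving the products of \<open>pd f' (v f)\<close> with \<open>pd f (v f')\<close>, which
  \<open>Re_ip_le\<close> splits into squared norms.\<close>

lemma nrm_sum_coord_le:
  assumes A: "finite A" "A \<subseteq> edges n" and adm: "\<And>f. f \<in> A \<Longrightarrow> admissible n (v f)"
  shows "nrm n z (\<lambda>x. \<Sum>f\<in>A. x f * v f x) \<le>
    (cmod z)\<^sup>2 * (\<Sum>f\<in>A. nrm n z (v f)) + (cmod z)^4 * (\<Sum>f\<in>A. \<Sum>f'\<in>A. nrm n z (pd f' (v f)))"
proof -
  define G where "G = (\<lambda>x. \<Sum>f\<in>A. x f * v f x)"
  have Ae: "f \<in> edges n" if "f \<in> A" for f using A that by auto
  have admG: "admissible n G" unfolding G_def by (intro admissible_sum admissible.coord adm Ae)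
  have apd: "admissible n (pd f' (v f))" if "f \<in> A" "f' \<in> A" for f f' by (intro admissible_pd adm Ae that)
  have pdG: "pd f G = (\<lambda>x. v f x + (\<Sum>f'\<in>A. x f' * pd f (v f') x))" if f: "f \<in> A" for f
  proof -
    have "has_partial f G (\<lambda>x. \<Sum>f'\<in>A. (if f' = f then 1 else 0) * v f' x + x f' * pd f (v f') x)"
      unfolding G_def by (intro has_partial_sum has_partial_mult has_partial_coord has_partial_pd[where n = n] adm Ae f)
    from pd_eq[OF this] show ?thesis
      using f A(1) by (simp add: sum.distrib fun_eq_iff if_distrib[of "\<lambda>c. c * _"] cong: if_cong)
  qed
  define c where "c = (cmod z)\<^sup>2"
  have "ip n z G G = (\<Sum>f\<in>A. ip n z (\<lambda>x. x f * v f x) G)"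
    by (subst (1) G_def, rule ip_sum_left) (auto intro: admissible.coord adm Ae admG)
  also have "\<dots> = (\<Sum>f\<in>A. of_real c * (ip n z (v f) (v f) + (\<Sum>f'\<in>A. ip n z (v f) (\<lambda>x. x f' * pd f (v f') x))))"
  proof (rule sum.cong[OF refl])
    fix f assume f: "f \<in> A"
    have "ip n z (\<lambda>x. x f * v f x) G = of_real c * ip n z (v f) (pd f G)"
      unfolding c_def by (rule ip_coord[OF adm[OF f] admG Ae[OF f]])
    also have "ip n z (v f) (pd f G) = ip n z (v f) (v f) + ip n z (v f) (\<lambda>x. \<Sum>f'\<in>A. x f' * pd f (v f') x)"
      unfolding pdG[OF f] by (intro ip_add_right admissible_sum admissible.coord adm Ae apd f)
    also have "ip n z (v f) (\<lambda>x. \<Sum>f'\<in>A. x f' * pd f (v f') x) = (\<Sum>f'\<in>A. ip n z (v f) (\<lambda>x. x f' * pd f (v f') x))"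
      by (intro ip_sum_right admissible.coord adm Ae apd f)
    finally show "ip n z (\<lambda>x. x f * v f x) G = of_real c * (ip n z (v f) (v f) + (\<Sum>f'\<in>A. ip n z (v f) (\<lambda>x. x f' * pd f (v f') x)))" .
  qed
  also have "\<dots> = (\<Sum>f\<in>A. of_real c * (of_real (nrm n z (v f)) + (\<Sum>f'\<in>A. of_real c * ip n z (pd f' (v f)) (pd f (v f')))))"
  proof (intro sum.cong refl arg_cong2[where f = "(*)"] arg_cong2[where f = "(+)"] ip_self)
    fix f f' assume f: "f \<in> A" "f' \<in> A"
    have "ip n z (v f) (\<lambda>x. x f' * pd f (v f') x) = cnj (ip n z (\<lambda>x. x f' * pd f (v f') x) (v f))"
      by (simp add: cnj_ip)
    also have "\<dots> = cnj (of_real c * ip n z (pd f (v f')) (pd f' (v f)))"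
      unfolding c_def by (subst ip_coord) (auto intro: apd adm Ae f)
    also have "\<dots> = of_real c * ip n z (pd f' (v f)) (pd f (v f'))" by (simp add: cnj_ip)
    finally show "ip n z (v f) (\<lambda>x. x f' * pd f (v f') x) = of_real c * ip n z (pd f' (v f)) (pd f (v f'))" .
  qed
  finally have "complex_of_real (nrm n z G) = \<dots>" by (simp add: ip_self)
  hence "nrm n z G = Re (\<Sum>f\<in>A. of_real c * (of_real (nrm n z (v f)) + (\<Sum>f'\<in>A. of_real c * ip n z (pd f' (v f)) (pd f (v f')))))"
    by (metis Re_complex_of_real)
  also have "\<dots> = c * (\<Sum>f\<in>A. nrm n z (v f)) + c\<^sup>2 * (\<Sum>f\<in>A. \<Sum>f'\<in>A. Re (ip n z (pd f' (v f)) (pd f (v f'))))"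
    by (simp add: distrib_left sum.distrib sum_distrib_left power2_eq_square mult.assoc)
  also have "(\<Sum>f\<in>A. \<Sum>f'\<in>A. Re (ip n z (pd f' (v f)) (pd f (v f')))) \<le>
      (\<Sum>f\<in>A. \<Sum>f'\<in>A. (nrm n z (pd f' (v f)) + nrm n z (pd f (v f'))) / 2)"
    by (intro sum_mono Re_ip_le apd)
  also have "\<dots> = (\<Sum>f\<in>A. \<Sum>f'\<in>A. nrm n z (pd f' (v f)) / 2) + (\<Sum>f\<in>A. \<Sum>f'\<in>A. nrm n z (pd f (v f')) / 2)"
    by (simp add: add_divide_distrib sum.distrib)
  \<comment> \<open>Exchanging the two indices identifies this half-sum with the other.\<close>
  also have "(\<Sum>f\<in>A. \<Sum>f'\<in>A. nrm n z (pd f (v f')) / 2) = (\<Sum>f\<in>A. \<Sum>f'\<in>A. nrm n z (pd f' (v f)) / 2)"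
    by (rule sum.swap)
  also have "(\<Sum>f\<in>A. \<Sum>f'\<in>A. nrm n z (pd f' (v f)) / 2) + (\<Sum>f\<in>A. \<Sum>f'\<in>A. nrm n z (pd f' (v f)) / 2) =
     (\<Sum>f\<in>A. \<Sum>f'\<in>A. nrm n z (pd f' (v f)))"
    by (simp flip: sum.distrib)
  finally show ?thesis by (simp add: G_def c_def mult_left_mono flip: power_mult)
qed

section \<open>Effect of vertex deletion on squared norms\<close>

lemma nrm_le2:
  assumes "admissible n f" "admissible n g" "admissible n h"
    and "\<And>x. (cmod (f x))\<^sup>2 \<le> a * (cmod (g x))\<^sup>2 + b * (cmod (h x))\<^sup>2"
  shows "nrm n z f \<le> a * nrm n z g + b * nrm n z h"
  using nrm_le[OF assms(1-3) admissible_zero, of a b 0] assms(4) by simp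

lemma nrm_pd_weighted_Z_le:
  assumes "e \<in> edges n"
  shows "nrm n z (pd e (weighted_Z n S)) \<le> 3 * (if ends e \<inter> S = {} then nrm n z (weighted_Z n (S \<union> ends e)) else 0)
    + 3 * nrm n z (weighted_Z n S) + 3 * nrm n z (\<lambda>x. nbhd_sum n e x * weighted_Z n S x)"
proof -
  define v where "v = (\<lambda>x. if ends e \<inter> S = {} then weighted_Z n (S \<union> ends e) x else 0)"
  have v: "admissible n v" unfolding v_def by (cases "ends e \<inter> S = {}") (auto intro: admissible_weighted_Z admissible_zero)
  have tri: "(cmod (a - b + c))\<^sup>2 \<le> 3 * (cmod a)\<^sup>2 + 3 * (cmod b)\<^sup>2 + 3 * (cmod c)\<^sup>2" for a b c
  proof -
    have "cmod (a - b + c) \<le> cmod a + cmod b + cmod c"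
      using norm_triangle_ineq[of "a - b" c] norm_triangle_ineq4[of a b] by linarith
    hence "(cmod (a - b + c))\<^sup>2 \<le> (cmod a + cmod b + cmod c)\<^sup>2" by (rule power_mono) simp
    moreover have "0 \<le> (cmod a - cmod b)\<^sup>2 + (cmod a - cmod c)\<^sup>2 + (cmod b - cmod c)\<^sup>2" by simp
    ultimately show ?thesis by (simp add: power2_eq_square algebra_simps)
  qed
  have "nrm n z (pd e (weighted_Z n S)) \<le> 3 * nrm n z v + 3 * nrm n z (weighted_Z n S) + 3 * nrm n z (\<lambda>x. nbhd_sum n e x * weighted_Z n S x)"
  proof (rule nrm_le)
    show "admissible n (pd e (weighted_Z n S))" by (intro admissible_pd admissible_weighted_Z assms)
    show "(cmod (pd e (weighted_Z n S) x))\<^sup>2 \<le> 3 * (cmod (v x))\<^sup>2 + 3 * (cmod (weighted_Z n S x))\<^sup>2 + 3 * (cmod (nbhd_sum n e x * weighted_Z n S x))\<^sup>2" for x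
      unfolding pd_weighted_Z[OF assms] v_def by (rule tri)
  qed (intro v admissible_weighted_Z admissible_nbhd_sum)+
  also have "nrm n z v = (if ends e \<inter> S = {} then nrm n z (weighted_Z n (S \<union> ends e)) else 0)"
    by (auto simp: v_def nrm_def)
  finally show ?thesis .
qed

text \<open>The small parameter: the total variance of the edge variables at one vertex.\<close>

abbreviation (input) "q \<equiv> real n * (cmod z)\<^sup>2"

lemma q_bounds: "0 \<le> q" "q \<le> 1 / 100" "q\<^sup>2 \<le> q / 100"
proof -
  show q: "0 \<le> q" "q \<le> 1 / 100" using z_small by auto
  show "q\<^sup>2 \<le> q / 100" using mult_left_mono[OF q(2,1)] by (simp add: power2_eq_square)
qed

text \<open>Uniform bounds inserted into \<open>nrm_sum_coord_le\<close>. It is applied with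
  \<open>k = 1\<close> to the edges at a vertex and with \<open>k = 2\<close> to a closed
  neighbourhood.\<close>

lemma nrm_sum_coord_le':
  assumes A: "finite A" "A \<subseteq> edges n" and adm: "\<And>f. f \<in> A \<Longrightarrow> admissible n (v f)"
    and card: "card A \<le> k * n" and a: "0 \<le> a" "0 \<le> b"
    and va: "\<And>f. f \<in> A \<Longrightarrow> nrm n z (v f) \<le> a"
    and vb: "\<And>f f'. f \<in> A \<Longrightarrow> f' \<in> A \<Longrightarrow> nrm n z (pd f' (v f)) \<le> b"
  shows "nrm n z (\<lambda>x. \<Sum>f\<in>A. x f * v f x) \<le> real k * q * a + (real k * q)\<^sup>2 * b"
proof -
  have c: "real (card A) \<le> real k * real n" using card by (simp flip: of_nat_mult)
  have "(\<Sum>f\<in>A. nrm n z (v f)) \<le> real (card A) * a" using sum_bounded_above[of A _ a] va by auto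
  also have "\<dots> \<le> real k * real n * a" using c a by (intro mult_right_mono)
  finally have 1: "(cmod z)\<^sup>2 * (\<Sum>f\<in>A. nrm n z (v f)) \<le> (cmod z)\<^sup>2 * (real k * real n * a)" by (intro mult_left_mono) auto
  have "(\<Sum>f\<in>A. \<Sum>f'\<in>A. nrm n z (pd f' (v f))) \<le> real (card A) * (real (card A) * b)"
    by (intro sum_bounded_above vb)
  also have "\<dots> \<le> (real k * real n) * ((real k * real n) * b)"
    using c a by (intro mult_mono) auto
  finally have 2: "(cmod z)^4 * (\<Sum>f\<in>A. \<Sum>f'\<in>A. nrm n z (pd f' (v f))) \<le> (cmod z)^4 * ((real k * real n) * ((real k * real n) * b))"
    by (intro mult_left_mono) auto
  have "(cmod z)\<^sup>2 * (real k * real n * a) + (cmod z)^4 * ((real k * real n) * ((real k * real n) * b)) = real k * q * a + (real k * q)\<^sup>2 * b"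
    by (simp add: power2_eq_square power4_eq_xxxx algebra_simps)
  moreover have "nrm n z (\<lambda>x. \<Sum>f\<in>A. x f * v f x) \<le>
      (cmod z)\<^sup>2 * (\<Sum>f\<in>A. nrm n z (v f)) + (cmod z)^4 * (\<Sum>f\<in>A. \<Sum>f'\<in>A. nrm n z (pd f' (v f)))"
    by (rule nrm_sum_coord_le[OF A adm])
  ultimately show ?thesis using 1 2 by linarith
qed

lemma edges_nonempty: "edges n \<noteq> {}"
  using n_pos by (auto simp: edges_def)

text \<open>The norm of \<open>nbhd_sum * weighted_Z\<close> reappears on the right-hand side, with a factor \<open>12 q\<^sup>2 < 1\<close>; it is absorbed.\<close>
lemma nrm_nbhd_sum_le:
  assumes del: "\<And>e. e \<in> edges n \<Longrightarrow> nrm n z (weighted_Z n (S \<union> ends e)) \<le> 4 * nrm n z (weighted_Z n S)"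
    and e: "e \<in> edges n"
  shows "nrm n z (\<lambda>x. nbhd_sum n e x * weighted_Z n S x) \<le> 3 * q * nrm n z (weighted_Z n S)"
proof -
  define U where "U = nrm n z (weighted_Z n S)"
  define N where "N = (\<lambda>e. nrm n z (\<lambda>x. nbhd_sum n e x * weighted_Z n S x))"
  \<comment> \<open>Bounding one \<open>N f\<close> involves \<open>N\<close> at the neighbours of
    \<open>f\<close>; the maximum over all edges closes the estimate.\<close>
  define m where "m = Max (N ` edges n)"
  have U0: "0 \<le> U" and N0: "0 \<le> N f" for f by (simp_all add: U_def N_def nrm_nonneg)
  have Nm: "N f \<le> m" if "f \<in> edges n" for f using that by (simp add: m_def)
  have m0: "0 \<le> m" using N0 Nm e order_trans by blast
  \<comment> \<open>\<open>15 = 3 * 4 + 3\<close>: the deleted term, bounded through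
    \<open>del\<close>, and the undeleted one.\<close>
  have pd: "nrm n z (pd f (weighted_Z n S)) \<le> 15 * U + 3 * m" if "f \<in> edges n" for f
  proof -
    have "(if ends f \<inter> S = {} then nrm n z (weighted_Z n (S \<union> ends f)) else 0) \<le> 4 * U"
      using del[OF that] U0 by (auto simp: U_def)
    thus ?thesis using nrm_pd_weighted_Z_le[OF that, of S] Nm[OF that] unfolding U_def N_def by linarith
  qed
  have bound: "N f \<le> 2 * q * U + 4 * q\<^sup>2 * (15 * U + 3 * m)" for f
  proof -
    have "N f = nrm n z (\<lambda>x. \<Sum>g\<in>nbhd n f. x g * weighted_Z n S x)"
      by (simp add: N_def nbhd_sum_def sum_distrib_right)
    also have "\<dots> \<le> real 2 * q * U + (real 2 * q)\<^sup>2 * (15 * U + 3 * m)"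
    proof (rule nrm_sum_coord_le')
      show "nrm n z (pd g (weighted_Z n S)) \<le> 15 * U + 3 * m" if "g \<in> nbhd n f" for g
        by (rule pd[OF nbhd_edge[OF that]])
    qed (use card_nbhd nbhd_subset U0 m0 admissible_weighted_Z in \<open>simp_all add: U_def\<close>)
    finally show ?thesis by (simp add: power_mult_distrib)
  qed
  have "m \<in> N ` edges n" unfolding m_def using edges_nonempty by (intro Max_in) auto
  then obtain f where "m = N f" by auto
  hence "m \<le> 2 * q * U + 4 * q\<^sup>2 * (15 * U + 3 * m)" using bound by simp
  \<comment> \<open>The coefficients become \<open>2 + 60 / 100 = 13 / 5\<close> for
    \<open>q * U\<close> and \<open>12 / 10000 = 3 / 2500\<close> for \<open>m\<close>; the latter
    is moved to the left.\<close>
  also have "\<dots> \<le> 2 * q * U + 4 * (q / 100) * (15 * U) + 4 * (1 / 10000) * (3 * m)"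
  proof -
    have "q\<^sup>2 * U \<le> q / 100 * U" using q_bounds(3) U0 by (rule mult_right_mono)
    moreover have "q\<^sup>2 * m \<le> 1 / 10000 * m" using q_bounds m0 by (intro mult_right_mono) auto
    ultimately show ?thesis by (simp add: algebra_simps)
  qed
  finally have "m \<le> 13 / 5 * (q * U) + 3 / 2500 * m" by (simp add: mult_ac)
  hence "m \<le> 3 * (q * U)" using mult_nonneg_nonneg[OF q_bounds(1) U0] by linarith
  thus ?thesis using Nm[OF e] by (simp add: N_def U_def mult.assoc)
qed

text \<open>The difference is the sum over the edges at \<open>v\<close> in the vertex expansion,
  estimated by \<open>nrm_sum_coord_le'\<close>. Everything is measured against
  \<open>insert v S\<close>, so that the hypotheses concern only sets containing it; this fits a
  downward induction.\<close>

lemma nrm_delete_vertex_le: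
  assumes v: "v \<notin> S"
    and del: "\<And>f. f \<in> incident_avoiding n S v \<Longrightarrow> nrm n z (weighted_Z n (S \<union> ends f)) \<le> 2 * nrm n z (weighted_Z n (insert v S))"
    and nb: "\<And>f e. f \<in> incident_avoiding n S v \<Longrightarrow> e \<in> edges n \<Longrightarrow>
       nrm n z (\<lambda>x. nbhd_sum n e x * weighted_Z n (S \<union> ends f) x) \<le> 3 * q * nrm n z (weighted_Z n (S \<union> ends f))"
  shows "nrm n z (\<lambda>x. weighted_Z n S x - weighted_Z n (insert v S) x) \<le> 3 * q * nrm n z (weighted_Z n (insert v S))"
proof -
  define V where "V = nrm n z (weighted_Z n (insert v S))"
  have V0: "0 \<le> V" by (simp add: V_def nrm_nonneg)
  have e: "f \<in> edges n" if "f \<in> incident_avoiding n S v" for f using that by (simp add: incident_avoiding_def)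
  have pd: "nrm n z (pd f' (weighted_Z n (S \<union> ends f))) \<le> 7 * V"
    if f: "f \<in> incident_avoiding n S v" "f' \<in> incident_avoiding n S v" for f f'
  proof -
    \<comment> \<open>Both edges contain \<open>v\<close>, so the doubly deleted term of the
      derivative vanishes. What remains is at most \<open>(6 + 18 / 100) * V\<close>.\<close>
    have meet: "ends f' \<inter> (S \<union> ends f) \<noteq> {}" using f by (auto simp: incident_avoiding_def)
    have "nrm n z (\<lambda>x. nbhd_sum n f' x * weighted_Z n (S \<union> ends f) x) \<le> 3 * q * nrm n z (weighted_Z n (S \<union> ends f))"
      by (rule nb[OF f(1) e[OF f(2)]])
    also have "\<dots> \<le> 3 * (1 / 100) * nrm n z (weighted_Z n (S \<union> ends f))"
      using q_bounds by (intro mult_right_mono nrm_nonneg) auto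
    finally show ?thesis
      using nrm_pd_weighted_Z_le[OF e[OF f(2)], of "S \<union> ends f"] meet del[OF f(1)] V0 unfolding V_def by simp
  qed
  have "nrm n z (\<lambda>x. weighted_Z n S x - weighted_Z n (insert v S) x) = nrm n z (\<lambda>x. \<Sum>f\<in>incident_avoiding n S v. x f * weighted_Z n (S \<union> ends f) x)"
    by (subst weighted_Z_vertex[OF v]) simp
  also have "\<dots> \<le> real 1 * q * (2 * V) + (real 1 * q)\<^sup>2 * (7 * V)"
  proof (rule nrm_sum_coord_le')
    show "nrm n z (weighted_Z n (S \<union> ends f)) \<le> 2 * V" if "f \<in> incident_avoiding n S v" for f
      unfolding V_def by (rule del[OF that])
  qed (use card_incident_avoiding e V0 pd admissible_weighted_Z in \<open>simp_all add: subset_iff\<close>)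
  also have "\<dots> \<le> 2 * (q * V) + q / 100 * (7 * V)"
    using mult_right_mono[OF q_bounds(3) V0] by (simp add: mult_ac)
  also have "\<dots> \<le> 3 * (q * V)" using mult_nonneg_nonneg[OF q_bounds(1) V0] by (simp add: mult_ac)
  finally show ?thesis by (simp add: V_def mult.assoc)
qed

text \<open>From \<open>b \<le> a + d\<close> follows
  \<open>b\<^sup>2 \<le> 3/2 * a\<^sup>2 + 3 * d\<^sup>2\<close>. Here \<open>d\<^sup>2\<close> is
  at most 3/100 of \<open>b\<^sup>2\<close>, and \<open>(3/2) / (1 - 9/100)\<close> is below
  2.\<close>

lemma nrm_insert_le_of_delete:
  assumes "nrm n z (\<lambda>x. weighted_Z n S x - weighted_Z n T x) \<le> 3 * q * nrm n z (weighted_Z n T)"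
  shows "nrm n z (weighted_Z n T) \<le> 2 * nrm n z (weighted_Z n S)"
proof -
  have "nrm n z (weighted_Z n T) \<le> (3/2) * nrm n z (weighted_Z n S) + 3 * nrm n z (\<lambda>x. weighted_Z n S x - weighted_Z n T x)"
  proof (rule nrm_le2)
    fix x
    let ?a = "cmod (weighted_Z n S x)" and ?d = "cmod (weighted_Z n S x - weighted_Z n T x)"
    have "cmod (weighted_Z n T x) \<le> ?a + ?d" using norm_triangle_sub[of "weighted_Z n T x" "weighted_Z n S x"] by (simp add: norm_minus_commute)
    hence "(cmod (weighted_Z n T x))\<^sup>2 \<le> (?a + ?d)\<^sup>2" by (rule power_mono) simp
    moreover have "0 \<le> (?a - 2 * ?d)\<^sup>2" by simp
    ultimately show "(cmod (weighted_Z n T x))\<^sup>2 \<le> (3/2) * ?a\<^sup>2 + 3 * ?d\<^sup>2"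
      by (simp add: power2_eq_square algebra_simps)
  qed (intro admissible_weighted_Z admissible_diff)+
  moreover have "3 * q * nrm n z (weighted_Z n T) \<le> 3 * (1 / 100) * nrm n z (weighted_Z n T)"
    using q_bounds by (intro mult_right_mono nrm_nonneg) auto
  note order_trans[OF assms this]
  ultimately show ?thesis using nrm_nonneg[of n z "weighted_Z n S"] nrm_nonneg[of n z "weighted_Z n T"] by linarith
qed

lemma Un_ends: "S \<union> ends f = insert (Inr (snd f)) (insert (Inl (fst f)) S)"
  by (auto simp: ends_def)

text \<open>Downward induction on \<open>S\<close>, measured by the number of vertices left.
  Expanding along \<open>v\<close> produces only sets containing \<open>insert v S\<close>, where
  the claim is already available.\<close>

lemma nrm_weighted_Z_insert_le: "nrm n z (weighted_Z n (insert v S)) \<le> 2 * nrm n z (weighted_Z n S)"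
proof (induction "card (Inl ` {1..n} \<union> Inr ` {1..n} - S)" arbitrary: S v rule: less_induct)
  case less
  define V where "V = (Inl ` {1..n} \<union> Inr ` {1..n} :: (nat + nat) set)"
  have finV: "finite V" by (simp add: V_def)
  show ?case
  proof (cases "v \<in> S")
    case True
    thus ?thesis using nrm_nonneg[of n z "weighted_Z n S"] by (simp add: insert_absorb)
  next
    case False
    \<comment> \<open>\<open>v \<in> V\<close> makes the measure drop strictly. It is supplied by
      any edge at \<open>v\<close>; if there is none, the hypotheses of the deletion estimate hold
      vacuously.\<close>
    have IH: "nrm n z (weighted_Z n (insert w T)) \<le> 2 * nrm n z (weighted_Z n T)" if "insert v S \<subseteq> T" "v \<in> V" for T w
    proof (rule less.hyps)
      show "card (Inl ` {1..n} \<union> Inr ` {1..n} - T) < card (Inl ` {1..n} \<union> Inr ` {1..n} - S)"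
        unfolding V_def[symmetric] using that False finV by (intro psubset_card_mono) auto
    qed
    have IH2: "nrm n z (weighted_Z n (T \<union> ends f)) \<le> 4 * nrm n z (weighted_Z n T)" if "insert v S \<subseteq> T" "v \<in> V" for T f
    proof -
      have "insert v S \<subseteq> insert (Inl (fst f)) T" using that by blast
      from IH[OF this that(2), of "Inr (snd f)"] IH[OF that, of "Inl (fst f)"] show ?thesis unfolding Un_ends by linarith
    qed
    have inc: "v \<in> V" "\<exists>w. S \<union> ends f = insert w (insert v S)" "insert v S \<subseteq> S \<union> ends f" if "f \<in> incident_avoiding n S v" for f
      using that by (auto simp: incident_avoiding_def ends_def V_def edges_def)
    show ?thesis
    proof (rule nrm_insert_le_of_delete, rule nrm_delete_vertex_le[OF False])
      fix f assume f: "f \<in> incident_avoiding n S v"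
      obtain w where "S \<union> ends f = insert w (insert v S)" using inc(2)[OF f] by blast
      thus "nrm n z (weighted_Z n (S \<union> ends f)) \<le> 2 * nrm n z (weighted_Z n (insert v S))"
        using IH[OF order_refl inc(1)[OF f], of w] by simp
      fix e assume e: "e \<in> edges n"
      show "nrm n z (\<lambda>x. nbhd_sum n e x * weighted_Z n (S \<union> ends f) x) \<le> 3 * q * nrm n z (weighted_Z n (S \<union> ends f))"
        by (rule nrm_nbhd_sum_le[OF IH2[OF inc(3)[OF f] inc(1)[OF f]] e])
    qed
  qed
qed

lemma nrm_weighted_Z_ends_le: "nrm n z (weighted_Z n (S \<union> ends f)) \<le> 4 * nrm n z (weighted_Z n S)"
  using nrm_weighted_Z_insert_le[of "Inl (fst f)" S] nrm_weighted_Z_insert_le[of "Inr (snd f)" "insert (Inl (fst f)) S"]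
  unfolding Un_ends by linarith

text \<open>With the induction complete, the hypotheses of \<open>nrm_delete_vertex_le\<close> hold
  for every \<open>S\<close>. Measuring against \<open>S\<close> in place of
  \<open>insert v S\<close> doubles the constant 3.\<close>

lemma nrm_weighted_Z_delete_le: "nrm n z (\<lambda>x. weighted_Z n S x - weighted_Z n (insert v S) x) \<le> 6 * q * nrm n z (weighted_Z n S)"
proof (cases "v \<in> S")
  case True
  hence "insert v S = S" by blast
  thus ?thesis using q_bounds nrm_nonneg[of n z "weighted_Z n S"] by (simp add: nrm_def)
next
  case False
  have "nrm n z (\<lambda>x. weighted_Z n S x - weighted_Z n (insert v S) x) \<le> 3 * q * nrm n z (weighted_Z n (insert v S))"
  proof (rule nrm_delete_vertex_le[OF False])
    fix f assume f: "f \<in> incident_avoiding n S v"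
    hence "\<exists>w. S \<union> ends f = insert w (insert v S)" by (auto simp: incident_avoiding_def ends_def)
    thus "nrm n z (weighted_Z n (S \<union> ends f)) \<le> 2 * nrm n z (weighted_Z n (insert v S))"
      using nrm_weighted_Z_insert_le by auto
  qed (intro nrm_nbhd_sum_le nrm_weighted_Z_ends_le)
  also have "\<dots> \<le> 3 * q * (2 * nrm n z (weighted_Z n S))"
    using q_bounds by (intro mult_left_mono nrm_weighted_Z_insert_le) auto
  finally show ?thesis by simp
qed

section \<open>Partial derivatives: a crude bound for all deleted sets, a sharp one for none\<close>

lemma nrm_pd_weighted_Z_le': "e \<in> edges n \<Longrightarrow> nrm n z (pd e (weighted_Z n S)) \<le> 16 * nrm n z (weighted_Z n S)"
proof -
  assume e: "e \<in> edges n"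
  have "nrm n z (\<lambda>x. nbhd_sum n e x * weighted_Z n S x) \<le> 3 * q * nrm n z (weighted_Z n S)"
    by (intro nrm_nbhd_sum_le nrm_weighted_Z_ends_le e)
  also have "\<dots> \<le> 3 * (1 / 100) * nrm n z (weighted_Z n S)"
    using q_bounds by (intro mult_right_mono nrm_nonneg) auto
  \<comment> \<open>The three contributions sum to \<open>3 * 4 + 3 + 9 / 100\<close>, below 16.
    Being of order 1 is enough, since this bound is later multiplied by
    \<open>q\<^sup>2\<close>.\<close>
  finally show ?thesis
    using nrm_pd_weighted_Z_le[OF e, of S] nrm_weighted_Z_ends_le[of S e] nrm_nonneg[of n z "weighted_Z n S"] by (auto split: if_splits)
qed

text \<open>Deleting the row vertex of \<open>e\<close> and then its column vertex writes
  \<open>weighted_Z n {} - weighted_Z n (ends e)\<close> as a sum over \<open>nbhd n e\<close>.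
  Setting this against the \<open>nbhd_sum\<close> term contributed by \<open>L2\<close> leaves only
  differences of weighted polynomials: the cancellation that the second-order correction is designed
  for.\<close>

lemma pd_weighted_Z_empty:
  assumes e: "e \<in> edges n"
  shows "pd e (weighted_Z n {}) = (\<lambda>x. \<Sum>f\<in>nbhd n e. x f * (weighted_Z n {} x - weighted_Z n (insert (Inl (fst e)) (ends f)) x))"
proof (rule ext)
  fix x
  let ?v = "Inl (fst e) :: nat + nat" and ?w = "Inr (snd e) :: nat + nat"
  \<comment> \<open>The edge \<open>e\<close> is counted with the row vertex; the second set keeps
    only the other edges at the column vertex.\<close>
  have nb: "nbhd n e = incident_avoiding n {} ?v \<union> incident_avoiding n {?v} ?w"
    by (auto simp: nbhd_def incident_avoiding_def ends_def)
  have disj: "incident_avoiding n {} ?v \<inter> incident_avoiding n {?v} ?w = {}"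
    by (auto simp: incident_avoiding_def)
  have "weighted_Z n {} x = weighted_Z n {?v} x + (\<Sum>f\<in>incident_avoiding n {} ?v. x f * weighted_Z n (ends f) x)"
    using weighted_Z_vertex[of ?v "{}" n x] by simp
  \<comment> \<open>These \<open>f\<close> already contain the row vertex, so inserting it changes
    nothing and gives both sums the same form.\<close>
  also have "(\<Sum>f\<in>incident_avoiding n {} ?v. x f * weighted_Z n (ends f) x) =
      (\<Sum>f\<in>incident_avoiding n {} ?v. x f * weighted_Z n (insert ?v (ends f)) x)"
    by (intro sum.cong refl) (auto simp: incident_avoiding_def insert_absorb)
  also have "weighted_Z n {?v} x = weighted_Z n {?w, ?v} x + (\<Sum>f\<in>incident_avoiding n {?v} ?w. x f * weighted_Z n (insert ?v (ends f)) x)"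
    using weighted_Z_vertex[of ?w "{?v}" n x] by simp
  also have "{?w, ?v} = ends e" by (auto simp: ends_def)
  finally have "weighted_Z n {} x = weighted_Z n (ends e) x + (\<Sum>f\<in>nbhd n e. x f * weighted_Z n (insert ?v (ends f)) x)"
    unfolding nb by (simp add: sum.union_disjoint[OF _ _ disj])
  thus "pd e (weighted_Z n {}) x = (\<Sum>f\<in>nbhd n e. x f * (weighted_Z n {} x - weighted_Z n (insert ?v (ends f)) x))"
    unfolding pd_weighted_Z[OF e] nbhd_sum_def by (simp add: right_diff_distrib sum_subtractf sum_distrib_right)
qed

text \<open>In the leading term one factor \<open>q\<close> comes from summing over the
  neighbourhood and another from the smallness of a difference under three vertex deletions. The
  derivative term carries \<open>q\<^sup>2\<close> by itself, so a crude bound suffices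
  there.\<close>

lemma nrm_pd_weighted_Z_empty_le:
  assumes e: "e \<in> edges n"
  shows "nrm n z (pd e (weighted_Z n {})) \<le> 1500 * q\<^sup>2 * nrm n z (weighted_Z n {})"
proof -
  define U where "U = nrm n z (weighted_Z n {})"
  have U0: "0 \<le> U" by (simp add: U_def nrm_nonneg)
  define T where "T = (\<lambda>f. insert (Inl (fst e)) (ends f))"
  have T: "T f = insert (Inl (fst e)) (insert (Inr (snd f)) (insert (Inl (fst f)) {}))" for f
    by (auto simp: T_def ends_def)
  have adm: "admissible n (\<lambda>x. weighted_Z n {} x - weighted_Z n (T f) x)" for f by (intro admissible_diff admissible_weighted_Z)
  have u2: "nrm n z (weighted_Z n (insert b {a})) \<le> 4 * U" for a b
    using nrm_weighted_Z_insert_le[of b "{a}"] nrm_weighted_Z_insert_le[of a "{}"] by (simp add: U_def)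
  have UT: "nrm n z (weighted_Z n (T f)) \<le> 8 * U" for f
    unfolding T using nrm_weighted_Z_insert_le[of "Inl (fst e)" "insert (Inr (snd f)) {Inl (fst f)}"] u2[of "Inr (snd f)" "Inl (fst f)"] by linarith
  \<comment> \<open>Telescoping over three deletions: the norms grow at most by 2 at each stage, so
    the constant is \<open>3 * (6 + 12 + 24) = 126\<close>.\<close>
  have a: "nrm n z (\<lambda>x. weighted_Z n {} x - weighted_Z n (T f) x) \<le> 126 * q * U" for f
  proof -
    let ?a = "Inl (fst f) :: nat + nat" and ?b = "Inr (snd f) :: nat + nat" and ?c = "Inl (fst e) :: nat + nat"
    have "nrm n z (\<lambda>x. weighted_Z n {} x - weighted_Z n (T f) x) \<le> 3 * nrm n z (\<lambda>x. weighted_Z n {} x - weighted_Z n {?a} x)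
        + 3 * nrm n z (\<lambda>x. weighted_Z n {?a} x - weighted_Z n {?b, ?a} x) + 3 * nrm n z (\<lambda>x. weighted_Z n {?b, ?a} x - weighted_Z n {?c, ?b, ?a} x)"
    proof (rule nrm_le)
      fix x
      let ?p = "weighted_Z n {} x - weighted_Z n {?a} x" and ?q = "weighted_Z n {?a} x - weighted_Z n {?b, ?a} x" and ?r = "weighted_Z n {?b, ?a} x - weighted_Z n {?c, ?b, ?a} x"
      have "weighted_Z n {} x - weighted_Z n (T f) x = ?p + ?q + ?r" by (simp add: T)
      moreover have "cmod (?p + ?q + ?r) \<le> cmod ?p + cmod ?q + cmod ?r"
        by (rule order_trans[OF norm_triangle_ineq add_right_mono[OF norm_triangle_ineq]])
      ultimately have "cmod (weighted_Z n {} x - weighted_Z n (T f) x) \<le> cmod ?p + cmod ?q + cmod ?r" by simp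
      hence "(cmod (weighted_Z n {} x - weighted_Z n (T f) x))\<^sup>2 \<le> (cmod ?p + cmod ?q + cmod ?r)\<^sup>2" by (rule power_mono) simp
      also have "\<dots> \<le> 3 * (cmod ?p)\<^sup>2 + 3 * (cmod ?q)\<^sup>2 + 3 * (cmod ?r)\<^sup>2"
      proof -
        have "0 \<le> (cmod ?p - cmod ?q)\<^sup>2 + (cmod ?p - cmod ?r)\<^sup>2 + (cmod ?q - cmod ?r)\<^sup>2" by simp
        thus ?thesis by (simp only: power2_eq_square) (simp add: algebra_simps)
      qed
      finally show "(cmod (weighted_Z n {} x - weighted_Z n (T f) x))\<^sup>2 \<le> 3 * (cmod ?p)\<^sup>2 + 3 * (cmod ?q)\<^sup>2 + 3 * (cmod ?r)\<^sup>2" .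
    qed (intro admissible_diff admissible_weighted_Z)+
    moreover have "nrm n z (\<lambda>x. weighted_Z n {} x - weighted_Z n {?a} x) \<le> 6 * q * U"
      unfolding U_def by (rule nrm_weighted_Z_delete_le)
    moreover have "nrm n z (\<lambda>x. weighted_Z n {?a} x - weighted_Z n {?b, ?a} x) \<le> 6 * q * (2 * U)"
      using q_bounds nrm_weighted_Z_insert_le[of ?a "{}"] unfolding U_def
      by (intro order_trans[OF nrm_weighted_Z_delete_le] mult_left_mono) auto
    moreover have "nrm n z (\<lambda>x. weighted_Z n {?b, ?a} x - weighted_Z n {?c, ?b, ?a} x) \<le> 6 * q * (4 * U)"
      using q_bounds u2[of ?b ?a] by (intro order_trans[OF nrm_weighted_Z_delete_le] mult_left_mono) auto
    ultimately show ?thesis by linarith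
  qed
  \<comment> \<open>\<open>288 = 2 * 16 + 2 * 16 * 8\<close>, with 8 the loss from three
    deletions.\<close>
  have b: "nrm n z (pd f' (\<lambda>x. weighted_Z n {} x - weighted_Z n (T f) x)) \<le> 288 * U" if "f' \<in> edges n" for f f'
  proof -
    note p = has_partial_pd[OF admissible_weighted_Z that]
    have "has_partial f' (\<lambda>x. weighted_Z n {} x + (- 1) * weighted_Z n (T f) x)
        (\<lambda>x. pd f' (weighted_Z n {}) x + (0 * weighted_Z n (T f) x + (- 1) * pd f' (weighted_Z n (T f)) x))"
      by (intro has_partial_add has_partial_mult has_partial_const p)
    hence pd: "pd f' (\<lambda>x. weighted_Z n {} x - weighted_Z n (T f) x) = (\<lambda>x. pd f' (weighted_Z n {}) x - pd f' (weighted_Z n (T f)) x)"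
      using pd_eq by fastforce
    have "nrm n z (pd f' (\<lambda>x. weighted_Z n {} x - weighted_Z n (T f) x)) \<le> 2 * nrm n z (pd f' (weighted_Z n {})) + 2 * nrm n z (pd f' (weighted_Z n (T f)))"
    proof (rule nrm_le2)
      show "admissible n (pd f' (\<lambda>x. weighted_Z n {} x - weighted_Z n (T f) x))" by (intro admissible_pd adm that)
      show "admissible n (pd f' (weighted_Z n {}))" "admissible n (pd f' (weighted_Z n (T f)))" by (intro admissible_pd admissible_weighted_Z that)+
      fix x
      let ?p = "pd f' (weighted_Z n {}) x" and ?q = "pd f' (weighted_Z n (T f)) x"
      have "(cmod (?p - ?q))\<^sup>2 \<le> (cmod ?p + cmod ?q)\<^sup>2" by (intro power_mono norm_triangle_ineq4) simp
      moreover have "0 \<le> (cmod ?p - cmod ?q)\<^sup>2" by simp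
      ultimately show "(cmod (pd f' (\<lambda>x. weighted_Z n {} x - weighted_Z n (T f) x) x))\<^sup>2 \<le> 2 * (cmod ?p)\<^sup>2 + 2 * (cmod ?q)\<^sup>2"
        unfolding pd by (simp only: power2_eq_square) (simp add: algebra_simps)
    qed
    thus ?thesis using nrm_pd_weighted_Z_le'[OF that, of "{}"] nrm_pd_weighted_Z_le'[OF that, of "T f"] UT[of f] unfolding U_def by linarith
  qed
  have "nrm n z (pd e (weighted_Z n {})) = nrm n z (\<lambda>x. \<Sum>f\<in>nbhd n e. x f * (weighted_Z n {} x - weighted_Z n (T f) x))"
    unfolding pd_weighted_Z_empty[OF e] T_def ..
  also have "\<dots> \<le> real 2 * q * (126 * q * U) + (real 2 * q)\<^sup>2 * (288 * U)"
  proof (rule nrm_sum_coord_le')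
    show "nrm n z (pd f' (\<lambda>x. weighted_Z n {} x - weighted_Z n (T f) x)) \<le> 288 * U" if "f' \<in> nbhd n e" for f f'
      by (rule b[OF nbhd_edge[OF that]])
  qed (use card_nbhd nbhd_subset U0 q_bounds a adm in simp_all)
  \<comment> \<open>\<open>1404 = 2 * 126 + 4 * 288\<close>.\<close>
  also have "\<dots> = 1404 * (q\<^sup>2 * U)" by (simp add: power2_eq_square algebra_simps)
  also have "\<dots> \<le> 1500 * (q\<^sup>2 * U)" using U0 by (intro mult_right_mono mult_nonneg_nonneg) auto
  finally show ?thesis by (simp add: U_def mult.assoc)
qed

end

section \<open>Differentiation in the scale\<close>

text \<open>The mean value inequality bounds all difference quotients by \<open>G\<close>, so
  dominated convergence applies along every sequence tending to \<open>s\<close>. Working within the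
  interval includes its end points.\<close>

lemma has_real_derivative_integral:
  fixes f f' :: "real \<Rightarrow> 'a \<Rightarrow> real"
  assumes s: "s \<in> {a..b}"
    and d: "\<And>t x. t \<in> {a..b} \<Longrightarrow> ((\<lambda>t. f t x) has_real_derivative f' t x) (at t within {a..b})"
    and i: "\<And>t. t \<in> {a..b} \<Longrightarrow> integrable M (f t)"
    and m: "f' s \<in> borel_measurable M"
    and bd: "\<And>t x. t \<in> {a..b} \<Longrightarrow> \<bar>f' t x\<bar> \<le> G x" and G: "integrable M G"
  shows "((\<lambda>t. \<integral>x. f t x \<partial>M) has_real_derivative (\<integral>x. f' s x \<partial>M)) (at s within {a..b})"
  unfolding has_field_derivative_iff tendsto_at_iff_sequentially comp_def
proof (intro allI impI)
  fix X assume X: "\<forall>i. X i \<in> {a..b} - {s}" "X \<longlonglongrightarrow> s"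
  have "(\<lambda>i. \<integral>x. (f (X i) x - f s x) / (X i - s) \<partial>M) \<longlonglongrightarrow> (\<integral>x. f' s x \<partial>M)"
  proof (rule integral_dominated_convergence[where w = G])
    show "(\<lambda>x. (f (X i) x - f s x) / (X i - s)) \<in> borel_measurable M" for i
    proof -
      have "X i \<in> {a..b}" using X by blast
      from borel_measurable_integrable[OF i[OF this]] borel_measurable_integrable[OF i[OF s]] show ?thesis by simp
    qed
    show "AE x in M. (\<lambda>i. (f (X i) x - f s x) / (X i - s)) \<longlonglongrightarrow> f' s x"
      using d[OF s, unfolded has_field_derivative_iff tendsto_at_iff_sequentially comp_def] X by (intro AE_I2) blast
    show "AE x in M. norm ((f (X i) x - f s x) / (X i - s)) \<le> G x" for i
    proof (rule AE_I2)
      fix x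
      have Xi: "X i \<in> {a..b}" "X i \<noteq> s" using X(1) by auto
      have "norm (f (X i) x - f s x) \<le> G x * norm (X i - s)"
        by (rule field_differentiable_bound[where S = "{a..b}" and f' = "\<lambda>t. f' t x"])
           (use d bd Xi s in auto)
      thus "norm ((f (X i) x - f s x) / (X i - s)) \<le> G x"
        using Xi by (simp add: divide_le_eq)
    qed
  qed (use m G in auto)
  moreover have "(\<integral>x. (f (X i) x - f s x) / (X i - s) \<partial>M) = ((\<integral>x. f (X i) x \<partial>M) - (\<integral>x. f s x \<partial>M)) / (X i - s)" for i
  proof -
    have "X i \<in> {a..b}" using X by blast
    from i[OF this] i[OF s] show ?thesis by simp
  qed
  ultimately show "(\<lambda>i. ((\<integral>x. f (X i) x \<partial>M) - (\<integral>x. f s x \<partial>M)) / (X i - s)) \<longlonglongrightarrow> (\<integral>x. f' s x \<partial>M)" by (simp only:)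
qed

text \<open>Only the empty matching survives at the origin; this supplies the initial value at scale
  0.\<close>

lemma weighted_Z_zero: "weighted_Z n {} (\<lambda>_. 0) = 1"
proof -
  have "Z_avoiding n {} (\<lambda>_. 0) = (\<Sum>M\<in>matchings_avoiding n {}. if M = {} then 1 else 0)"
    unfolding Z_avoiding_def
  proof (rule sum.cong[OF refl])
    fix M assume "M \<in> matchings_avoiding n {}"
    hence "finite M" by (rule finite_subset[OF matchings_avoiding_subset]) simp
    thus "(\<Prod>e\<in>M. 0 :: complex) = (if M = {} then 1 else 0)" by (simp add: power_0_left)
  qed
  also have "\<dots> = 1" by (subst sum.delta) (auto simp: matchings_avoiding_def matchings_def)
  finally show ?thesis by (simp add: weighted_Z_def L12_def)
qed

context gaussian_scale
begin

section \<open>The squared norm as a function of the scale\<close>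

lemma gaussian_scale_shrink: "s \<in> {0..1} \<Longrightarrow> gaussian_scale n (of_real s * z)"
proof
  assume s: "s \<in> {0..1}"
  have "real n * (cmod (of_real s * z))\<^sup>2 = s\<^sup>2 * q" by (simp add: norm_mult power_mult_distrib)
  also have "\<dots> \<le> 1 * q" using s q_bounds(1) by (intro mult_right_mono) (auto simp: power_le_one)
  finally show "real n * (cmod (of_real s * z))\<^sup>2 \<le> 1 / 100" using z_small by simp
qed (rule n_pos)

text \<open>Differentiation under the integral, with the pointwise derivative from
  \<open>admissible_ray\<close>. The dominating exponent is 1/4 each for \<open>g\<close>, its
  partial derivative and the entry \<open>W e\<close>, in total 3/4.\<close>

lemma nrm_scale_has_derivative:
  assumes g: "admissible n g" and s: "s \<in> {0..1}"
  shows "((\<lambda>s. nrm n (of_real s * z) g) has_real_derivative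
     (\<integral>W. 2 * Re (cnj (g (\<lambda>e. of_real s * (z * W e))) * (\<Sum>e\<in>edges n. z * W e * pd e g (\<lambda>e. of_real s * (z * W e))))
       \<partial>gaussian_matrix n)) (at s within {0..1})"
proof -
  define f' where "f' = (\<lambda>s W. 2 * Re (cnj (g (\<lambda>e. of_real s * (z * W e))) *
      (\<Sum>e\<in>edges n. z * W e * pd e g (\<lambda>e. of_real s * (z * W e)))))"
  \<comment> \<open>One constant serves all \<open>s\<close> in the unit interval, since
    \<open>admissible_gaussian_growth\<close> is uniform in the scale.\<close>
  have gr: "\<exists>A\<ge>0. \<forall>s\<in>{0..1}. \<forall>W. cmod (h (\<lambda>e. of_real s * (z * W e))) \<le> A * exp (1/4 * (\<Sum>e\<in>edges n. (cmod (W e))\<^sup>2))"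
    if "admissible n h" for h
  proof -
    note h = that
    obtain A where A: "A \<ge> 0" "\<And>z W. real n * (cmod z)\<^sup>2 \<le> 1 / 12 \<Longrightarrow>
        cmod (h (\<lambda>e. z * W e)) \<le> A * exp (1 / 4 * (\<Sum>e\<in>edges n. (cmod (W e))\<^sup>2))"
      using admissible_gaussian_growth[OF h n_pos] by blast
    have "cmod (h (\<lambda>e. of_real s * (z * W e))) \<le> A * exp (1/4 * (\<Sum>e\<in>edges n. (cmod (W e))\<^sup>2))" if s: "s \<in> {0..1}" for s W
    proof -
      interpret s: gaussian_scale n "of_real s * z" by (rule gaussian_scale_shrink[OF s])
      show ?thesis using A(2)[of "of_real s * z" W] s.z_small by (simp add: mult.assoc)
    qed
    thus ?thesis using A(1) by blast
  qed
  obtain A where A: "A \<ge> 0" "\<And>s W. s \<in> {0..1} \<Longrightarrow> cmod (g (\<lambda>e. of_real s * (z * W e))) \<le> A * exp (1/4 * (\<Sum>e\<in>edges n. (cmod (W e))\<^sup>2))"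
    using gr[OF g] by blast
  have "\<forall>e\<in>edges n. \<exists>B\<ge>0. \<forall>s\<in>{0..1}. \<forall>W. cmod (pd e g (\<lambda>e. of_real s * (z * W e))) \<le> B * exp (1/4 * (\<Sum>e\<in>edges n. (cmod (W e))\<^sup>2))"
    using gr[OF admissible_pd[OF g]] by blast
  from bchoice[OF this] obtain B where B': "\<forall>f\<in>edges n. B f \<ge> 0 \<and> (\<forall>s\<in>{0..1}. \<forall>W.
      cmod (pd f g (\<lambda>e. of_real s * (z * W e))) \<le> B f * exp (1/4 * (\<Sum>e\<in>edges n. (cmod (W e))\<^sup>2)))" ..
  have B: "B f \<ge> 0" "\<And>s W. s \<in> {0..1} \<Longrightarrow>
      cmod (pd f g (\<lambda>e. of_real s * (z * W e))) \<le> B f * exp (1/4 * (\<Sum>e\<in>edges n. (cmod (W e))\<^sup>2))"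
    if "f \<in> edges n" for f
    using B' that by blast+
  \<comment> \<open>The 5 is \<open>1 + 1 / \<epsilon>\<close> of \<open>exp_growth_times\<close> at
    \<epsilon> = 1/4.\<close>
  define D where "D = 2 * (A * (\<Sum>e\<in>edges n. cmod z * 5 * B e))"
  have meas: "(\<lambda>W. h (\<lambda>e. of_real s * (z * W e))) \<in> borel_measurable (gaussian_matrix n)" if "admissible n h" for h
    using admissible_measurable_gaussian[OF that, of "of_real s * z"] by (simp add: mult.assoc)
  have "((\<lambda>s. \<integral>W. (cmod (g (\<lambda>e. of_real s * (z * W e))))\<^sup>2 \<partial>gaussian_matrix n) has_real_derivative
      (\<integral>W. f' s W \<partial>gaussian_matrix n)) (at s within {0..1})"
  proof (rule has_real_derivative_integral[OF s, where G = "\<lambda>W. D * exp (3/4 * (\<Sum>e\<in>edges n. (cmod (W e))\<^sup>2))"])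
    fix t :: real and W :: "nat \<times> nat \<Rightarrow> complex" assume t: "t \<in> {0..1}"
    define y where "y = (\<lambda>e. z * W e)"
    define w' where "w' = (\<Sum>e\<in>edges n. y e * pd e g (\<lambda>e. of_real t * y e))"
    let ?w = "\<lambda>t. g (\<lambda>e. of_real t * y e)"
    have w: "(?w has_vector_derivative w') (at t)" unfolding w'_def by (rule admissible_ray[OF g])
    have D: "((\<lambda>t. Re (?w t)) has_real_derivative Re w') (at t)" "((\<lambda>t. Im (?w t)) has_real_derivative Im w') (at t)"
      using bounded_linear.has_vector_derivative[OF bounded_linear_Re w] bounded_linear.has_vector_derivative[OF bounded_linear_Im w]
      by (simp_all add: has_real_derivative_iff_has_vector_derivative)
    have "((\<lambda>t. Re (?w t) * Re (?w t) + Im (?w t) * Im (?w t)) has_real_derivative 2 * Re (cnj (?w t) * w')) (at t)"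
      by (rule DERIV_cong[OF DERIV_add[OF DERIV_mult[OF D(1) D(1)] DERIV_mult[OF D(2) D(2)]]]) (simp add: algebra_simps)
    hence "((\<lambda>t. (cmod (?w t))\<^sup>2) has_real_derivative 2 * Re (cnj (?w t) * w')) (at t)"
      unfolding cmod_power2 unfolding power2_eq_square .
    thus "((\<lambda>t. (cmod (g (\<lambda>e. of_real t * (z * W e))))\<^sup>2) has_real_derivative f' t W) (at t within {0..1})"
      unfolding f'_def y_def w'_def by (rule has_field_derivative_at_within)
    define E where "E = (\<Sum>e\<in>edges n. (cmod (W e))\<^sup>2)"
    have "cmod (\<Sum>e\<in>edges n. z * W e * pd e g (\<lambda>e. of_real t * (z * W e))) \<le> (\<Sum>e\<in>edges n. (cmod z * 5 * B e) * exp (1/2 * E))"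
    proof (rule order_trans[OF norm_sum sum_mono])
      fix e assume e: "e \<in> edges n"
      have "(cmod (W e))\<^sup>2 \<le> E" unfolding E_def by (rule member_le_sum) (use e in auto)
      hence le: "5 * exp (1/4 * (cmod (W e))\<^sup>2) \<le> 5 * exp (1/4 * E)" by simp
      have "cmod (W e) \<le> 5 * exp (1/4 * (cmod (W e))\<^sup>2)"
        using exp_growth_times[of "1/4" "cmod (W e)"] by simp
      from this le have We: "cmod (W e) \<le> 5 * exp (1/4 * E)" by (rule order_trans)
      have "cmod (z * W e * pd e g (\<lambda>e. of_real t * (z * W e))) \<le> cmod z * (5 * exp (1/4 * E)) * (B e * exp (1/4 * E))"
        unfolding norm_mult using We B(1)[OF e] B(2)[OF e t, of W] unfolding E_def[symmetric]
        by (intro mult_mono mult_left_mono) auto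
      also have "\<dots> = (cmod z * 5 * B e) * (exp (1/4 * E) * exp (1/4 * E))" by (simp add: mult_ac)
      also have "exp (1/4 * E) * exp (1/4 * E) = exp (1/2 * E)" by (simp flip: exp_add)
      finally show "cmod (z * W e * pd e g (\<lambda>e. of_real t * (z * W e))) \<le> (cmod z * 5 * B e) * exp (1/2 * E)" .
    qed
    hence "cmod (cnj (g (\<lambda>e. of_real t * (z * W e))) * (\<Sum>e\<in>edges n. z * W e * pd e g (\<lambda>e. of_real t * (z * W e))))
       \<le> (A * exp (1/4 * E)) * ((\<Sum>e\<in>edges n. cmod z * 5 * B e) * exp (1/2 * E))"
      unfolding norm_mult complex_mod_cnj sum_distrib_right using A(1) A(2)[OF t, of W] unfolding E_def[symmetric]
      by (intro mult_mono) auto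
    also have "\<dots> = D / 2 * (exp (1/4 * E) * exp (1/2 * E))" by (simp add: D_def)
    also have "exp (1/4 * E) * exp (1/2 * E) = exp (3/4 * E)" by (simp flip: exp_add)
    finally have "2 * cmod (cnj (g (\<lambda>e. of_real t * (z * W e))) * (\<Sum>e\<in>edges n. z * W e * pd e g (\<lambda>e. of_real t * (z * W e))))
       \<le> D * exp (3/4 * E)" by simp
    moreover have "\<bar>f' t W\<bar> \<le> 2 * cmod (cnj (g (\<lambda>e. of_real t * (z * W e))) * (\<Sum>e\<in>edges n. z * W e * pd e g (\<lambda>e. of_real t * (z * W e))))"
      unfolding f'_def abs_mult by (intro mult_mono abs_Re_le_cmod) auto
    ultimately show "\<bar>f' t W\<bar> \<le> D * exp (3/4 * (\<Sum>e\<in>edges n. (cmod (W e))\<^sup>2))" unfolding E_def by linarith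
  next
    fix t :: real assume "t \<in> {0..1}"
    then interpret s: gaussian_scale n "of_real t * z" by (rule gaussian_scale_shrink)
    show "integrable (gaussian_matrix n) (\<lambda>W. (cmod (g (\<lambda>e. of_real t * (z * W e))))\<^sup>2)"
      using s.integrable_nrm[OF g] by (simp add: mult.assoc)
  next
    have "cnj \<in> borel_measurable borel" by (intro borel_measurable_continuous_onI continuous_intros)
    note c = measurable_compose[OF meas[OF g] this]
    have S: "(\<lambda>W. \<Sum>e\<in>edges n. z * W e * pd e g (\<lambda>e. of_real s * (z * W e))) \<in> borel_measurable (gaussian_matrix n)"
      by (intro borel_measurable_sum borel_measurable_times[OF measurable_gaussian_coord meas] admissible_pd g)
    show "f' s \<in> borel_measurable (gaussian_matrix n)"
      unfolding f'_def
      by (rule borel_measurable_times[OF borel_measurable_const measurable_compose[OF borel_measurable_times[OF c S] borel_measurable_Re]])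
  next
    show "integrable (gaussian_matrix n) (\<lambda>W. D * exp (3/4 * (\<Sum>e\<in>edges n. (cmod (W e))\<^sup>2)))"
      by (intro integrable_mult_right integrable_gaussian_matrix_exp) simp
  qed
  thus ?thesis by (simp add: nrm_def f'_def mult.assoc)
qed

text \<open>The extra factor \<open>s\<close> turns \<open>z * W e\<close> into the coordinate at
  scale \<open>s * z\<close>. Then \<open>ip_coord\<close> applied to \<open>pd e g\<close> gives
  its squared norm times the squared modulus of the scale.\<close>

lemma nrm_scale_deriv_eq:
  assumes g: "admissible n g" and s: "s \<in> {0..1}"
  shows "s * (\<integral>W. 2 * Re (cnj (g (\<lambda>e. of_real s * (z * W e))) * (\<Sum>e\<in>edges n. z * W e * pd e g (\<lambda>e. of_real s * (z * W e))))
       \<partial>gaussian_matrix n) = 2 * s\<^sup>2 * (cmod z)\<^sup>2 * (\<Sum>e\<in>edges n. nrm n (of_real s * z) (pd e g))"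
proof -
  let ?z = "of_real s * z"
  interpret s: gaussian_scale n ?z by (rule gaussian_scale_shrink[OF s])
  have pt: "s * (2 * Re (cnj (g (\<lambda>e. of_real s * (z * W e))) * (\<Sum>e\<in>edges n. z * W e * pd e g (\<lambda>e. of_real s * (z * W e)))))
      = 2 * (\<Sum>e\<in>edges n. Re ((?z * W e * pd e g (\<lambda>e. ?z * W e)) * cnj (g (\<lambda>e. ?z * W e))))" for W
  proof -
    have "s * Re c = Re (of_real s * c)" for c by simp
    hence "s * (2 * Re (cnj (g (\<lambda>e. of_real s * (z * W e))) * (\<Sum>e\<in>edges n. z * W e * pd e g (\<lambda>e. of_real s * (z * W e)))))
      = 2 * Re (of_real s * (cnj (g (\<lambda>e. ?z * W e)) * (\<Sum>e\<in>edges n. z * W e * pd e g (\<lambda>e. ?z * W e))))"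
      by (simp only: mult.assoc mult.left_commute[of s 2])
    also have "of_real s * (cnj (g (\<lambda>e. ?z * W e)) * (\<Sum>e\<in>edges n. z * W e * pd e g (\<lambda>e. ?z * W e))) =
        (\<Sum>e\<in>edges n. (?z * W e * pd e g (\<lambda>e. ?z * W e)) * cnj (g (\<lambda>e. ?z * W e)))"
      unfolding sum_distrib_left by (intro sum.cong refl) (simp add: mult_ac)
    finally show ?thesis by (simp only: Re_sum)
  qed
  have int: "integrable (gaussian_matrix n) (\<lambda>W. (?z * W e * pd e g (\<lambda>e. ?z * W e)) * cnj (g (\<lambda>e. ?z * W e)))" if "e \<in> edges n" for e
    using s.integrable_ip[OF admissible.coord[OF admissible_pd[OF g that] that] g] .
  have "s * (\<integral>W. 2 * Re (cnj (g (\<lambda>e. of_real s * (z * W e))) * (\<Sum>e\<in>edges n. z * W e * pd e g (\<lambda>e. of_real s * (z * W e))))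
       \<partial>gaussian_matrix n) = (\<integral>W. 2 * (\<Sum>e\<in>edges n. Re ((?z * W e * pd e g (\<lambda>e. ?z * W e)) * cnj (g (\<lambda>e. ?z * W e)))) \<partial>gaussian_matrix n)"
    unfolding pt[symmetric] by (simp only: integral_mult_right_zero)
  also have "\<dots> = 2 * (\<Sum>e\<in>edges n. \<integral>W. Re ((?z * W e * pd e g (\<lambda>e. ?z * W e)) * cnj (g (\<lambda>e. ?z * W e))) \<partial>gaussian_matrix n)"
    unfolding integral_mult_right_zero
    by (subst Bochner_Integration.integral_sum) (auto intro!: integrable_Re int simp del: times_complex.sel)
  also have "(\<Sum>e\<in>edges n. \<integral>W. Re ((?z * W e * pd e g (\<lambda>e. ?z * W e)) * cnj (g (\<lambda>e. ?z * W e))) \<partial>gaussian_matrix n)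
      = (\<Sum>e\<in>edges n. Re (ip n ?z (\<lambda>x. x e * pd e g x) g))"
    unfolding ip_def by (intro sum.cong refl integral_Re int)
  also have "\<dots> = (\<Sum>e\<in>edges n. (cmod ?z)\<^sup>2 * nrm n ?z (pd e g))"
  proof (rule sum.cong[OF refl])
    fix e assume e: "e \<in> edges n"
    show "Re (ip n ?z (\<lambda>x. x e * pd e g x) g) = (cmod ?z)\<^sup>2 * nrm n ?z (pd e g)"
      unfolding s.ip_coord[OF admissible_pd[OF g e] g e] s.ip_self by (simp flip: of_real_power)
  qed
  finally show ?thesis by (simp add: norm_mult power_mult_distrib sum_distrib_left mult_ac)
qed

text \<open>A Gronwall argument along the scale, from the value 1 at scale 0 to the full scale
  1.\<close>

lemma nrm_weighted_Z_empty_le: "nrm n z (weighted_Z n {}) \<le> exp (500 * (real n ^ 4 * cmod z ^ 6))"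
proof -
  define K where "K = real n ^ 4 * cmod z ^ 6"
  define \<phi> where "\<phi> = (\<lambda>s. nrm n (of_real s * z) (weighted_Z n {}))"
  define \<phi>' where "\<phi>' = (\<lambda>s. \<integral>W. 2 * Re (cnj (weighted_Z n {} (\<lambda>e. of_real s * (z * W e))) *
      (\<Sum>e\<in>edges n. z * W e * pd e (weighted_Z n {}) (\<lambda>e. of_real s * (z * W e)))) \<partial>gaussian_matrix n)"
  have d: "(\<phi> has_real_derivative \<phi>' s) (at s within {0..1})" if "s \<in> {0..1}" for s
    unfolding \<phi>_def \<phi>'_def by (rule nrm_scale_has_derivative[OF admissible_weighted_Z that])
  \<comment> \<open>There are \<open>n\<^sup>2\<close> edges, each contributing
    \<open>1500 * (s\<^sup>2 * q)\<^sup>2\<close>. Together with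
    \<open>2 * s\<^sup>2 * (cmod z)\<^sup>2\<close> this is \<open>3000 * K * s ^ 6\<close>, and
    \<open>s > 0\<close> permits cancelling one \<open>s\<close>.\<close>
  have le: "\<phi>' s \<le> 3000 * K * s ^ 5 * \<phi> s" if s: "0 < s" "s < 1" for s
  proof -
    have s01: "s \<in> {0..1}" using s by simp
    interpret s: gaussian_scale n "of_real s * z" by (rule gaussian_scale_shrink[OF s01])
    have q: "real n * (cmod (of_real s * z))\<^sup>2 = s\<^sup>2 * q" by (simp add: norm_mult power_mult_distrib)
    have "s * \<phi>' s = 2 * s\<^sup>2 * (cmod z)\<^sup>2 * (\<Sum>e\<in>edges n. nrm n (of_real s * z) (pd e (weighted_Z n {})))"
      unfolding \<phi>'_def by (rule nrm_scale_deriv_eq[OF admissible_weighted_Z s01])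
    also have "(\<Sum>e\<in>edges n. nrm n (of_real s * z) (pd e (weighted_Z n {}))) \<le> real (card (edges n)) * (1500 * (s\<^sup>2 * q)\<^sup>2 * \<phi> s)"
      unfolding \<phi>_def q[symmetric] by (intro sum_bounded_above s.nrm_pd_weighted_Z_empty_le)
    hence "2 * s\<^sup>2 * (cmod z)\<^sup>2 * (\<Sum>e\<in>edges n. nrm n (of_real s * z) (pd e (weighted_Z n {}))) \<le>
        2 * s\<^sup>2 * (cmod z)\<^sup>2 * ((real n)\<^sup>2 * (1500 * (s\<^sup>2 * q)\<^sup>2 * \<phi> s))"
      by (intro mult_left_mono) (auto simp: card_edges)
    also have "\<dots> = s * (3000 * K * s ^ 5 * \<phi> s)"
      by (simp add: K_def eval_nat_numeral)
    finally show ?thesis using s by simp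
  qed
  \<comment> \<open>The integrating factor of the differential inequality, with
    \<open>500 = 3000 / 6\<close>; it makes \<open>h\<close> nonincreasing.\<close>
  define h where "h = (\<lambda>s. \<phi> s * exp (- 500 * K * s ^ 6))"
  have dh: "(h has_real_derivative (\<phi>' s - 3000 * K * s ^ 5 * \<phi> s) * exp (- 500 * K * s ^ 6)) (at s within {0..1})"
    if "s \<in> {0..1}" for s
    unfolding h_def by (rule derivative_eq_intros d that refl)+ (simp add: algebra_simps)
  have "h 1 \<le> h 0"
  proof (rule DERIV_nonpos_imp_decreasing_open[where f = h and a = 0 and b = 1])
    show "continuous_on {0..1} h" using dh by (rule DERIV_continuous_on)
    fix s :: real assume s: "0 < s" "s < 1"
    have "(h has_real_derivative (\<phi>' s - 3000 * K * s ^ 5 * \<phi> s) * exp (- 500 * K * s ^ 6)) (at s)"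
      using dh[of s] s by (simp add: at_within_Icc_at)
    moreover have "(\<phi>' s - 3000 * K * s ^ 5 * \<phi> s) * exp (- 500 * K * s ^ 6) \<le> 0"
      using le[OF s] by (intro mult_nonpos_nonneg) auto
    ultimately show "\<exists>y. (h has_real_derivative y) (at s) \<and> y \<le> 0" by blast
  qed simp
  moreover have "h 0 = 1"
  proof -
    interpret prob_space "gaussian_matrix n" by (rule prob_space_gaussian_matrix)
    show ?thesis by (simp add: h_def \<phi>_def nrm_def weighted_Z_zero prob_space)
  qed
  ultimately have "nrm n z (weighted_Z n {}) * exp (- 500 * K) \<le> 1" by (simp add: h_def \<phi>_def)
  hence "nrm n z (weighted_Z n {}) * exp (- 500 * K) * exp (500 * K) \<le> 1 * exp (500 * K)" by (intro mult_right_mono) auto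
  thus ?thesis by (simp add: mult.assoc K_def flip: exp_add)
qed

end

section \<open>Conclusion: the second moment bound\<close>

theorem mainTheorem15:
  shows "\<exists>c>0. \<exists>C>0. \<forall>(n::nat) (z::complex). real n * (cmod z)\<^sup>2 \<le> c \<longrightarrow>
           integrable (gaussian_matrix n) (\<lambda>W. (cmod (X2 n z W))\<^sup>2) \<and>
           ln (prob_space.expectation (gaussian_matrix n) (\<lambda>W. (cmod (X2 n z W))\<^sup>2))
             \<le> C * real n ^ 4 * cmod z ^ 6"
proof (rule exI[of _ "1 / 100"], intro conjI, simp, rule exI[of _ 500], intro conjI allI impI)
  fix n :: nat and z :: complex
  assume z: "real n * (cmod z)\<^sup>2 \<le> 1 / 100"
  interpret P: prob_space "gaussian_matrix n" by (rule prob_space_gaussian_matrix)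
  have X2: "X2 n z W = weighted_Z n {} (\<lambda>e. z * W e)" for W by (simp add: X2_def F2_eq_weighted_Z)
  have "integrable (gaussian_matrix n) (\<lambda>W. (cmod (X2 n z W))\<^sup>2) \<and>
      P.expectation (\<lambda>W. (cmod (X2 n z W))\<^sup>2) \<le> exp (500 * real n ^ 4 * cmod z ^ 6)"
  \<comment> \<open>\<open>gaussian_scale\<close> requires \<open>n \<ge> 1\<close>. For
    \<open>n = 0\<close> the empty matching is the only one and the random variable is constantly
    1.\<close>
  proof (cases "n = 0")
    case True
    hence "edges n = {}" by (simp add: edges_def)
    moreover from this have "matchings n = {{}}" by (auto simp: matchings_def)
    ultimately have "X2 n z W = 1" for W
      by (simp add: X2 weighted_Z_def L12_def flip: Z_eq) (simp add: Z_def)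
    thus ?thesis by (simp add: P.prob_space)
  next
    case False
    interpret gaussian_scale n z using False z by unfold_locales auto
    show ?thesis
      using integrable_nrm[OF admissible_weighted_Z, of "{}"] nrm_weighted_Z_empty_le by (simp add: X2 nrm_def mult.assoc)
  qed
  hence int: "integrable (gaussian_matrix n) (\<lambda>W. (cmod (X2 n z W))\<^sup>2)"
    and le: "P.expectation (\<lambda>W. (cmod (X2 n z W))\<^sup>2) \<le> exp (500 * real n ^ 4 * cmod z ^ 6)" by auto
  show "integrable (gaussian_matrix n) (\<lambda>W. (cmod (X2 n z W))\<^sup>2)" by (rule int)
  show "ln (P.expectation (\<lambda>W. (cmod (X2 n z W))\<^sup>2)) \<le> 500 * real n ^ 4 * cmod z ^ 6"
  \<comment> \<open>Positivity of the expectation need not be shown: by the convention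
    \<open>ln 0 = 0\<close> the degenerate case is trivial, the right-hand side being
    nonnegative.\<close>
  proof (cases "P.expectation (\<lambda>W. (cmod (X2 n z W))\<^sup>2) = 0")
    case False
    moreover have "0 \<le> P.expectation (\<lambda>W. (cmod (X2 n z W))\<^sup>2)" by simp
    ultimately have "0 < P.expectation (\<lambda>W. (cmod (X2 n z W))\<^sup>2)" by linarith
    hence "ln (P.expectation (\<lambda>W. (cmod (X2 n z W))\<^sup>2)) \<le> ln (exp (500 * real n ^ 4 * cmod z ^ 6))"
      using le by (subst ln_le_cancel_iff) auto
    thus ?thesis by simp
  qed simp
qed simp

end
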